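(* Let $\mathcal{T}:=\bigcup_{n\in\mathbb{N}}\{0,1\}^n$ be the dyadic tree and let $E$ be the completion of $c_{00}(\mathcal{T})$ under the norm $$\|x\|_{E}:=\sup_{n\in \mathbb{N}}\left(\sum_{\sigma\in \{0,1\}^n} \Big(\sup_{\tau\succeq \sigma}|x(\tau)|\Big)^2\right)^{1/2}.$$ Let $\lambda$ be the Lebesgue measure on $[0,1]$. Then the dual space $E^*$ fails property $(\delta\mathcal{S}_\lambda)$; that is, there is a relatively weakly compact subset of $L^1(\lambda,E^* )$ which is not a $\delta\mathcal{S}$-set.
   Context: Banach spaces are real. $\mathcal{T}$ is the set of all non-empty finite sequences of $0$'s and $1$'s ($\mathbb{N}=\{1,2,\dots\}$), partially ordered by: $\tau\succeq\sigma$ if $\tau$ extends $\sigma$ (including $\tau=\sigma$). $c_{00}(\mathcal{T})$ is the linear space of finitely supported real-valued functions on $\mathcal{T}$. For a probability space $(\Omega,\Sigma,\mu)$ and a Banach space $X$, $L^1(\mu,X)$ is the Lebesgue-Bochner space of (equivalence classes of) Bochner integrable functions $f:\Omega\to X$ with norm $\int_\Omega\|f(\cdot)\|_X\,d\mu$. For $f\in L^1(\mu,X)$ and a Borel set $C\subseteq X$, $\mu(f^{-1}(C))$ is computed with any $\Sigma$-$\mathrm{Borel}(X)$ measurable representative of $f$. A set $K\subseteq L^1(\mu,X)$ is uniformly integrable if it is bounded and for every $\varepsilon>0$ there is $\delta>0$ such that $\sup_{f\in K}\int_A\|f(\cdot)\|_X\,d\mu\le\varepsilon$ for every $A\in\Sigma$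 with $\mu(A)\le\delta$. A set $K\subseteq L^1(\mu,X)$ is a $\delta\mathcal{S}$-set if it is uniformly integrable and for every $\delta>0$ there is a weakly compact set $W\subseteq X$ such that $\mu(f^{-1}(W))\ge 1-\delta$ for every $f\in K$. $X$ has property $(\delta\mathcal{S}_\mu)$ if every relatively weakly compact subset of $L^1(\mu,X)$ is a $\delta\mathcal{S}$-set. *)

theory Defs
  imports "HOL-Analysis.Analysis" "HOL-Library.Sublist"
begin

section \<open>Completion of a real normed space\<close>

text \<open>The metric completion, as the space of Cauchy sequences modulo null sequences.\<close>

definition cauchy_eq :: "(nat \<Rightarrow> 'a::real_normed_vector) \<Rightarrow> (nat \<Rightarrow> 'a) \<Rightarrow> bool" where
  "cauchy_eq X Y \<longleftrightarrow> Cauchy X \<and> Cauchy Y \<and> (\<lambda>n. X n - Y n) \<longlonglongrightarrow> 0"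

lemma Cauchy_scaleR_seq:
  fixes X :: "nat \<Rightarrow> 'a::real_normed_vector"
  assumes "Cauchy X"
  shows "Cauchy (\<lambda>n. c *\<^sub>R X n)"
  using bounded_linear.Cauchy[OF bounded_linear_scaleR_right assms] .

lemma Cauchy_add_seq:
  fixes X Y :: "nat \<Rightarrow> 'a::real_normed_vector"
  assumes "Cauchy X" "Cauchy Y"
  shows "Cauchy (\<lambda>n. X n + Y n)"
proof (rule metric_CauchyI)
  fix e :: real assume "e > 0"
  then obtain M N where "\<forall>m\<ge>M. \<forall>n\<ge>M. dist (X m) (X n) < e / 2"
    and "\<forall>m\<ge>N. \<forall>n\<ge>N. dist (Y m) (Y n) < e / 2"
    using assms unfolding Cauchy_def by (metis half_gt_zero)
  then have "\<forall>m\<ge>max M N. \<forall>n\<ge>max M N. dist (X m + Y m) (X n + Y n) < e"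
    by (metis dist_triangle_add_half max.bounded_iff)
  then show "\<exists>M. \<forall>m\<ge>M. \<forall>n\<ge>M. dist (X m + Y m) (X n + Y n) < e" by blast
qed

lemma Cauchy_norm_convergent:
  fixes X :: "nat \<Rightarrow> 'a::real_normed_vector"
  assumes "Cauchy X"
  shows "convergent (\<lambda>n. norm (X n))"
proof -
  have "Cauchy (\<lambda>n. norm (X n))"
  proof (rule metric_CauchyI)
    fix e :: real assume "e > 0"
    then obtain M where "\<forall>m\<ge>M. \<forall>n\<ge>M. dist (X m) (X n) < e"
      using assms unfolding Cauchy_def by blast
    then show "\<exists>M. \<forall>m\<ge>M. \<forall>n\<ge>M. dist (norm (X m)) (norm (X n)) < e"
      by (metis dist_norm norm_triangle_ineq3 real_norm_def order_le_less_trans)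
  qed
  then show ?thesis by (rule Cauchy_convergent)
qed

lemma cauchy_eq_refl: "Cauchy X \<Longrightarrow> cauchy_eq X X"
  by (simp add: cauchy_eq_def)

lemma cauchy_eq_sym: "cauchy_eq X Y \<Longrightarrow> cauchy_eq Y X"
  using tendsto_minus[of "\<lambda>n. X n - Y n" 0 sequentially] by (simp add: cauchy_eq_def)

lemma cauchy_eq_trans:
  assumes "cauchy_eq X Y" "cauchy_eq Y Z" shows "cauchy_eq X Z"
  using assms tendsto_add[of "\<lambda>n. X n - Y n" 0 sequentially "\<lambda>n. Y n - Z n" 0]
  by (simp add: cauchy_eq_def)

quotient_type (overloaded) 'a banach_completion =
  "nat \<Rightarrow> 'a::real_normed_vector" / partial: cauchy_eq
proof (rule part_equivpI)
  show "\<exists>X. cauchy_eq X X"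
    by (rule exI[of _ "\<lambda>_. 0"]) (simp add: cauchy_eq_refl Cauchy_def)
  show "symp cauchy_eq" by (auto intro: sympI cauchy_eq_sym)
  show "transp cauchy_eq" by (auto intro: transpI cauchy_eq_trans)
qed

lemma cauchy_eq_norm_lim:
  assumes "cauchy_eq X Y"
  shows "lim (\<lambda>n. norm (X n)) = lim (\<lambda>n. norm (Y n))"
proof -
  have X: "(\<lambda>n. norm (X n)) \<longlonglongrightarrow> lim (\<lambda>n. norm (X n))"
    and Y: "(\<lambda>n. norm (Y n)) \<longlonglongrightarrow> lim (\<lambda>n. norm (Y n))"
    using assms by (auto simp: cauchy_eq_def convergent_LIMSEQ_iff[symmetric] Cauchy_norm_convergent)
  have "(\<lambda>n. norm (X n) - norm (Y n)) \<longlonglongrightarrow> 0"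
  proof (rule Lim_null_comparison)
    show "\<forall>\<^sub>F n in sequentially. norm (norm (X n) - norm (Y n)) \<le> norm (X n - Y n)"
      by (simp add: norm_triangle_ineq3)
    show "(\<lambda>n. norm (X n - Y n)) \<longlonglongrightarrow> 0"
      using assms by (simp add: cauchy_eq_def tendsto_norm_zero)
  qed
  with tendsto_diff[OF X Y] show ?thesis
    using LIMSEQ_unique by fastforce
qed

instantiation banach_completion :: (real_normed_vector) real_vector
begin

lift_definition zero_banach_completion :: "'a banach_completion" is "\<lambda>_. 0"
  by (simp add: cauchy_eq_def Cauchy_def)

lift_definition plus_banach_completion ::
  "'a banach_completion \<Rightarrow> 'a banach_completion \<Rightarrow> 'a banach_completion"
  is "\<lambda>X Y n. X n + Y n"
proof -
  fix X X' Y Y' :: "nat \<Rightarrow> 'a"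
  assume a: "cauchy_eq X X'" "cauchy_eq Y Y'"
  then have "(\<lambda>n. (X n - X' n) + (Y n - Y' n)) \<longlonglongrightarrow> 0"
    using tendsto_add[of "\<lambda>n. X n - X' n" 0 sequentially "\<lambda>n. Y n - Y' n" 0]
    by (simp add: cauchy_eq_def)
  with a show "cauchy_eq (\<lambda>n. X n + Y n) (\<lambda>n. X' n + Y' n)"
    by (simp add: cauchy_eq_def Cauchy_add_seq add_diff_add)
qed

lift_definition uminus_banach_completion :: "'a banach_completion \<Rightarrow> 'a banach_completion"
  is "\<lambda>X n. - X n"
proof -
  fix X X' :: "nat \<Rightarrow> 'a"
  assume a: "cauchy_eq X X'"
  then have "(\<lambda>n. - (X n - X' n)) \<longlonglongrightarrow> 0"
    using tendsto_minus[of "\<lambda>n. X n - X' n" 0 sequentially] by (simp add: cauchy_eq_def)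
  with a show "cauchy_eq (\<lambda>n. - X n) (\<lambda>n. - X' n)"
    using Cauchy_scaleR_seq[of X "-1"] Cauchy_scaleR_seq[of X' "-1"]
    by (simp add: cauchy_eq_def)
qed

definition minus_banach_completion ::
  "'a banach_completion \<Rightarrow> 'a banach_completion \<Rightarrow> 'a banach_completion" where
  "x - y = x + - (y :: 'a banach_completion)"

lift_definition scaleR_banach_completion ::
  "real \<Rightarrow> 'a banach_completion \<Rightarrow> 'a banach_completion"
  is "\<lambda>c X n. c *\<^sub>R X n"
proof -
  fix c :: real and X X' :: "nat \<Rightarrow> 'a"
  assume a: "cauchy_eq X X'"
  then have "(\<lambda>n. c *\<^sub>R (X n - X' n)) \<longlonglongrightarrow> c *\<^sub>R 0"
    by (intro tendsto_scaleR tendsto_const) (simp add: cauchy_eq_def)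
  with a show "cauchy_eq (\<lambda>n. c *\<^sub>R X n) (\<lambda>n. c *\<^sub>R X' n)"
    by (simp add: cauchy_eq_def Cauchy_scaleR_seq scaleR_diff_right)
qed

instance
proof
  fix a b c :: "'a banach_completion" and r s :: real
  show "a + b + c = a + (b + c)"
    by transfer (simp add: add.assoc cauchy_eq_def Cauchy_add_seq)
  show "a + b = b + a"
    by transfer (simp add: add.commute cauchy_eq_def Cauchy_add_seq)
  show "0 + a = a"
    by transfer (simp add: cauchy_eq_def)
  show "- a + a = 0"
    by transfer (simp add: cauchy_eq_def Cauchy_def)
  show "a - b = a + - b"
    by (rule minus_banach_completion_def)
  show "r *\<^sub>R (a + b) = r *\<^sub>R a + r *\<^sub>R b"
    by transfer (simp add: cauchy_eq_def scaleR_add_right Cauchy_add_seq Cauchy_scaleR_seq)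
  show "(r + s) *\<^sub>R a = r *\<^sub>R a + s *\<^sub>R a"
    by transfer (simp add: cauchy_eq_def scaleR_add_left Cauchy_add_seq Cauchy_scaleR_seq)
  show "r *\<^sub>R s *\<^sub>R a = (r * s) *\<^sub>R a"
    by transfer (simp add: cauchy_eq_def Cauchy_scaleR_seq)
  show "1 *\<^sub>R a = a"
    by transfer (simp add: cauchy_eq_def)
qed

end

instantiation banach_completion :: (real_normed_vector) real_normed_vector
begin

lift_definition norm_banach_completion :: "'a banach_completion \<Rightarrow> real"
  is "\<lambda>X. lim (\<lambda>n. norm (X n))"
  by (rule cauchy_eq_norm_lim)

definition dist_banach_completion :: "'a banach_completion \<Rightarrow> 'a banach_completion \<Rightarrow> real" where
  "dist x y = norm (x - y :: 'a banach_completion)"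

definition sgn_banach_completion :: "'a banach_completion \<Rightarrow> 'a banach_completion" where
  "sgn x = x /\<^sub>R norm (x :: 'a banach_completion)"

definition uniformity_banach_completion ::
  "('a banach_completion \<times> 'a banach_completion) filter" where
  "uniformity_banach_completion =
     (INF e\<in>{0<..}. principal {(x, y :: 'a banach_completion). dist x y < e})"

definition open_banach_completion :: "'a banach_completion set \<Rightarrow> bool" where
  "open_banach_completion U \<longleftrightarrow>
     (\<forall>x\<in>U. \<forall>\<^sub>F (x', y) in uniformity. x' = x \<longrightarrow> y \<in> U)"

lemma Cauchy_lim_norm:
  fixes X :: "nat \<Rightarrow> 'a"
  assumes "Cauchy X"
  shows "(\<lambda>n. norm (X n)) \<longlonglongrightarrow> lim (\<lambda>n. norm (X n))"
  using Cauchy_norm_convergent[OF assms] by (simp add: convergent_LIMSEQ_iff)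

instance
proof
  fix x y :: "'a banach_completion" and r :: real and U :: "'a banach_completion set"
  show "dist x y = norm (x - y)" by (rule dist_banach_completion_def)
  show "sgn x = x /\<^sub>R norm x" by (rule sgn_banach_completion_def)
  show "(uniformity :: ('a banach_completion \<times> 'a banach_completion) filter)
      = (INF e\<in>{0<..}. principal {(x, y). dist x y < e})"
    by (rule uniformity_banach_completion_def)
  show "open U \<longleftrightarrow> (\<forall>x\<in>U. \<forall>\<^sub>F (x', y) in uniformity. x' = x \<longrightarrow> y \<in> U)"
    by (rule open_banach_completion_def)
  show "norm x = 0 \<longleftrightarrow> x = 0"
  proof (transfer)
    fix X :: "nat \<Rightarrow> 'a"
    assume "cauchy_eq X X"
    then have X: "Cauchy X" by (simp add: cauchy_eq_def)
    show "lim (\<lambda>n. norm (X n)) = 0 \<longleftrightarrow> cauchy_eq X (\<lambda>_. 0)"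
    proof
      assume "lim (\<lambda>n. norm (X n)) = 0"
      then have "X \<longlonglongrightarrow> 0" using Cauchy_lim_norm[OF X] by (simp add: tendsto_norm_zero_iff)
      with X show "cauchy_eq X (\<lambda>_. 0)" by (simp add: cauchy_eq_def Cauchy_def)
    next
      assume "cauchy_eq X (\<lambda>_. 0)"
      then have "(\<lambda>n. norm (X n)) \<longlonglongrightarrow> 0" by (simp add: cauchy_eq_def tendsto_norm_zero)
      then show "lim (\<lambda>n. norm (X n)) = 0" by (rule limI)
    qed
  qed
  show "norm (x + y) \<le> norm x + norm y"
  proof (transfer)
    fix X Y :: "nat \<Rightarrow> 'a"
    assume "cauchy_eq X X" "cauchy_eq Y Y"
    then have XY: "Cauchy X" "Cauchy Y" by (simp_all add: cauchy_eq_def)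
    show "lim (\<lambda>n. norm (X n + Y n)) \<le> lim (\<lambda>n. norm (X n)) + lim (\<lambda>n. norm (Y n))"
      by (rule LIMSEQ_le[OF Cauchy_lim_norm[OF Cauchy_add_seq[OF XY]]
            tendsto_add[OF Cauchy_lim_norm[OF XY(1)] Cauchy_lim_norm[OF XY(2)]]])
         (auto intro: norm_triangle_ineq)
  qed
  show "norm (r *\<^sub>R x) = \<bar>r\<bar> * norm x"
  proof (transfer)
    fix r :: real and X :: "nat \<Rightarrow> 'a"
    assume "cauchy_eq X X"
    then have X: "Cauchy X" by (simp add: cauchy_eq_def)
    show "lim (\<lambda>n. norm (r *\<^sub>R X n)) = \<bar>r\<bar> * lim (\<lambda>n. norm (X n))"
      by (rule limI) (simp add: tendsto_mult_left Cauchy_lim_norm[OF X])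
  qed
qed

end

lift_definition completion_embed :: "'a::real_normed_vector \<Rightarrow> 'a banach_completion"
  is "\<lambda>x _. x"
  by (simp add: cauchy_eq_def Cauchy_def)

lemma completion_embed_add: "completion_embed (x + y) = completion_embed x + completion_embed y"
  by transfer (simp add: cauchy_eq_def Cauchy_def)

lemma completion_embed_scaleR: "completion_embed (c *\<^sub>R x) = c *\<^sub>R completion_embed x"
  by transfer (simp add: cauchy_eq_def Cauchy_def)

lemma linear_completion_embed: "linear completion_embed"
  by (rule linearI) (rule completion_embed_add completion_embed_scaleR)+

lemma norm_completion_embed: "norm (completion_embed x) = norm x"
  by transfer (simp add: limI)

lemma dist_completion_embed: "dist (completion_embed x) (completion_embed y) = dist x y"
  using norm_completion_embed[of "x - y"] linear_diff[OF linear_completion_embed]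
  by (metis dist_norm)

lemma completion_embed_tendsto:
  fixes X :: "nat \<Rightarrow> 'a::real_normed_vector"
  assumes "Cauchy X"
  shows "(\<lambda>k. completion_embed (X k)) \<longlonglongrightarrow> abs_banach_completion X"
proof (rule metric_LIMSEQ_I)
  fix e :: real assume "e > 0"
  then obtain N where N: "\<forall>m\<ge>N. \<forall>n\<ge>N. dist (X m) (X n) < e / 2"
    using assms unfolding Cauchy_def by (metis half_gt_zero)
  have "dist (completion_embed (X k)) (abs_banach_completion X) < e" if "k \<ge> N" for k
  proof -
    have c: "Cauchy (\<lambda>n. X k + - 1 *\<^sub>R X n)"
      by (intro Cauchy_add_seq Cauchy_scaleR_seq assms) (simp add: Cauchy_def)
    have m: "- abs_banach_completion X = abs_banach_completion (\<lambda>n. - X n)"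
      by (rule uminus_banach_completion.abs_eq) (simp add: cauchy_eq_refl assms)
    have m': "completion_embed (X k) + abs_banach_completion (\<lambda>n. - X n)
      = abs_banach_completion (\<lambda>n. X k + - X n)"
      unfolding completion_embed.abs_eq
      using Cauchy_scaleR_seq[OF assms, of "-1"]
      by (intro plus_banach_completion.abs_eq) (simp_all add: cauchy_eq_refl Cauchy_def)
    have "dist (completion_embed (X k)) (abs_banach_completion X)
        = norm (abs_banach_completion (\<lambda>n. X k + - X n))"
      by (simp only: dist_banach_completion_def minus_banach_completion_def m m')
    also have "\<dots> = lim (\<lambda>n. norm (X k + - X n))"
      using c by (intro norm_banach_completion.abs_eq) (simp add: cauchy_eq_refl)
    also have "\<dots> \<le> e / 2"
    proof (rule LIMSEQ_le_const2[OF Cauchy_lim_norm])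
      show "Cauchy (\<lambda>n. X k + - X n)" using c by simp
      show "\<exists>M. \<forall>n\<ge>M. norm (X k + - X n) \<le> e / 2"
        using N that by (intro exI[of _ N]) (auto simp: dist_norm less_imp_le)
    qed
    finally show ?thesis using \<open>e > 0\<close> by simp
  qed
  then show "\<exists>N. \<forall>k\<ge>N. dist (completion_embed (X k)) (abs_banach_completion X) < e" by blast
qed

lemma banach_completion_cases:
  obtains X where "Cauchy X" "x = abs_banach_completion X"
  by (induct x rule: banach_completion.abs_induct) (auto simp: cauchy_eq_def)

lemma completion_embed_approx:
  fixes x :: "'a::real_normed_vector banach_completion"
  assumes "e > 0"
  shows "\<exists>a. dist (completion_embed a) x < e"
proof -
  obtain X where "Cauchy X" "x = abs_banach_completion X" by (rule banach_completion_cases)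
  then show ?thesis
    using metric_LIMSEQ_D[OF completion_embed_tendsto[of X] assms] by blast
qed

lemma closure_range_completion_embed:
  "closure (range (completion_embed :: 'a::real_normed_vector \<Rightarrow> _)) = UNIV"
  using completion_embed_approx by (fastforce simp: closure_approachable)

instance banach_completion :: (real_normed_vector) banach
proof
  fix X :: "nat \<Rightarrow> 'a banach_completion"
  assume X: "Cauchy X"
  have "\<exists>A. \<forall>n. dist (completion_embed (A n)) (X n) < inverse (real (Suc n))"
    by (intro choice allI completion_embed_approx) simp
  then obtain A :: "nat \<Rightarrow> 'a"
    where A: "\<And>n. dist (completion_embed (A n)) (X n) < inverse (real (Suc n))" by blast
  have d: "(\<lambda>n. dist (completion_embed (A n)) (X n)) \<longlonglongrightarrow> 0"
  proof (rule tendsto_sandwich[OF _ _ tendsto_const LIMSEQ_inverse_real_of_nat])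
    show "\<forall>\<^sub>F n in sequentially. dist (completion_embed (A n)) (X n) \<le> inverse (real (Suc n))"
      by (intro always_eventually allI less_imp_le A)
  qed simp
  have "Cauchy A"
  proof (rule metric_CauchyI)
    fix e :: real assume e: "e > 0"
    obtain N where N: "\<forall>m\<ge>N. \<forall>n\<ge>N. dist (X m) (X n) < e / 3"
      using X e unfolding Cauchy_def by (metis divide_pos_pos zero_less_numeral)
    obtain M where M: "\<forall>n\<ge>M. dist (completion_embed (A n)) (X n) < e / 3"
      using order_tendstoD(2)[OF d, of "e / 3"] e by (auto simp: eventually_sequentially)
    have "dist (A m) (A n) < e" if "m \<ge> max M N" "n \<ge> max M N" for m n
    proof -
      have "dist (completion_embed (A m)) (X m) < e / 3" "dist (X m) (X n) < e / 3"
        "dist (completion_embed (A n)) (X n) < e / 3"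
        using N M that by auto
      then have "dist (completion_embed (A m)) (completion_embed (A n)) < e"
        using dist_triangle[of "completion_embed (A m)" "completion_embed (A n)" "X m"]
          dist_triangle[of "X m" "completion_embed (A n)" "X n"]
        by (simp add: dist_commute)
      then show ?thesis by (simp add: dist_completion_embed)
    qed
    then show "\<exists>M. \<forall>m\<ge>M. \<forall>n\<ge>M. dist (A m) (A n) < e" by blast
  qed
  then have "(\<lambda>n. completion_embed (A n)) \<longlonglongrightarrow> abs_banach_completion A"
    by (rule completion_embed_tendsto)
  moreover have "(\<lambda>n. X n - completion_embed (A n)) \<longlonglongrightarrow> 0"
    by (rule tendsto_norm_zero_cancel) (use d in \<open>simp add: dist_norm norm_minus_commute\<close>)
  ultimately have "X \<longlonglongrightarrow> abs_banach_completion A"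
    by (rule Lim_transform)
  then show "convergent X" by (rule convergentI)
qed


section \<open>The dyadic tree and the space E\<close>

typedef dyadic_tree = "{\<sigma> :: bool list. \<sigma> \<noteq> []}"
  morphisms word_of Abs_dyadic_tree
  by (rule exI[of _ "[True]"]) simp

definition level :: "dyadic_tree \<Rightarrow> nat" where
  "level \<sigma> = length (word_of \<sigma>)"

definition extends :: "dyadic_tree \<Rightarrow> dyadic_tree \<Rightarrow> bool"  (infix "\<succeq>" 50) where
  "\<tau> \<succeq> \<sigma> \<longleftrightarrow> prefix (word_of \<sigma>) (word_of \<tau>)"

lemma extends_refl: "\<tau> \<succeq> \<tau>"
  by (simp add: extends_def)

lemma extends_same_level:
  "\<tau> \<succeq> \<sigma> \<Longrightarrow> \<tau> \<succeq> \<sigma>' \<Longrightarrow> level \<sigma> = level \<sigma>' \<Longrightarrow> \<sigma> = \<sigma>'"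
  unfolding extends_def level_def
  by (metis word_of_inject prefix_def append_eq_append_conv)

lemma finite_level: "finite {\<sigma>. level \<sigma> = n}"
proof (rule finite_imageD)
  show "finite (word_of ` {\<sigma>. level \<sigma> = n})"
    by (rule finite_subset[OF _ finite_lists_length_eq[of "UNIV :: bool set" n]])
       (auto simp: level_def)
  show "inj_on word_of {\<sigma>. level \<sigma> = n}" by (simp add: inj_on_def word_of_inject)
qed

lemma level_pos: "level \<sigma> \<ge> 1"
  using word_of[of \<sigma>] by (simp add: level_def Suc_le_eq)

typedef c00_tree = "{x :: dyadic_tree \<Rightarrow> real. finite {\<tau>. x \<tau> \<noteq> 0}}"
  morphisms coord Abs_c00_tree
  by (rule exI[of _ "\<lambda>_. 0"]) simp

setup_lifting type_definition_c00_tree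

definition subtree_sup :: "(dyadic_tree \<Rightarrow> real) \<Rightarrow> dyadic_tree \<Rightarrow> real" where
  "subtree_sup x \<sigma> = (SUP \<tau>\<in>{\<tau>. \<tau> \<succeq> \<sigma>}. \<bar>x \<tau>\<bar>)"

definition level_norm :: "(dyadic_tree \<Rightarrow> real) \<Rightarrow> nat \<Rightarrow> real" where
  "level_norm x n = sqrt (\<Sum>\<sigma>\<in>{\<sigma>. level \<sigma> = n}. (subtree_sup x \<sigma>)\<^sup>2)"

definition tree_norm :: "(dyadic_tree \<Rightarrow> real) \<Rightarrow> real" where
  "tree_norm x = (SUP n\<in>{1..}. level_norm x n)"

lemma level_norm_L2: "level_norm x n = L2_set (subtree_sup x) {\<sigma>. level \<sigma> = n}"
  by (simp add: level_norm_def L2_set_def)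

lemma subtree_bdd:
  fixes x :: "dyadic_tree \<Rightarrow> real"
  assumes "finite {\<tau>. x \<tau> \<noteq> 0}"
  shows "bdd_above ((\<lambda>\<tau>. \<bar>x \<tau>\<bar>) ` A)"
proof -
  have "range x \<subseteq> insert 0 (x ` {\<tau>. x \<tau> \<noteq> 0})" by auto
  then have "finite (range x)" using assms finite_subset by blast
  then have "finite ((\<lambda>\<tau>. \<bar>x \<tau>\<bar>) ` A)"
    by (metis finite_imageI finite_subset image_image subset_UNIV image_mono)
  then show ?thesis by (rule bdd_above_finite)
qed

lemma subtree_sup_upper:
  assumes "finite {\<tau>. x \<tau> \<noteq> 0}" "\<tau> \<succeq> \<sigma>"
  shows "\<bar>x \<tau>\<bar> \<le> subtree_sup x \<sigma>"
  unfolding subtree_sup_def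
  by (rule cSUP_upper) (use assms subtree_bdd in auto)

lemma subtree_sup_least:
  assumes "\<And>\<tau>. \<tau> \<succeq> \<sigma> \<Longrightarrow> \<bar>x \<tau>\<bar> \<le> b"
  shows "subtree_sup x \<sigma> \<le> b"
  unfolding subtree_sup_def
  by (rule cSUP_least) (use assms extends_refl in auto)

lemma subtree_sup_nonneg:
  assumes "finite {\<tau>. x \<tau> \<noteq> 0}"
  shows "0 \<le> subtree_sup x \<sigma>"
  using subtree_sup_upper[OF assms extends_refl, of \<sigma>] by linarith

lemma level_norm_bound:
  assumes fin: "finite {\<tau>. x \<tau> \<noteq> 0}"
  shows "level_norm x n \<le> (\<Sum>\<tau>\<in>{\<tau>. x \<tau> \<noteq> 0}. \<bar>x \<tau>\<bar>)"
proof -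
  let ?S = "{\<tau>. x \<tau> \<noteq> 0}" and ?L = "{\<sigma>. level \<sigma> = n}"
  have "level_norm x n \<le> (\<Sum>\<sigma>\<in>?L. subtree_sup x \<sigma>)"
    unfolding level_norm_L2 by (intro L2_set_le_sum subtree_sup_nonneg fin)
  also have "\<dots> \<le> (\<Sum>\<sigma>\<in>?L. \<Sum>\<tau>\<in>?S. if \<tau> \<succeq> \<sigma> then \<bar>x \<tau>\<bar> else 0)"
  proof (intro sum_mono subtree_sup_least)
    fix \<sigma> \<tau> assume t: "\<tau> \<succeq> \<sigma>"
    show "\<bar>x \<tau>\<bar> \<le> (\<Sum>\<tau>\<in>?S. if \<tau> \<succeq> \<sigma> then \<bar>x \<tau>\<bar> else 0)"
    proof (cases "\<tau> \<in> ?S")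
      case True
      then show ?thesis
        using t member_le_sum[of \<tau> ?S "\<lambda>\<tau>. if \<tau> \<succeq> \<sigma> then \<bar>x \<tau>\<bar> else 0"] fin by simp
    next
      case False
      then show ?thesis by (auto intro: sum_nonneg)
    qed
  qed
  also have "\<dots> = (\<Sum>\<tau>\<in>?S. \<Sum>\<sigma>\<in>?L. if \<tau> \<succeq> \<sigma> then \<bar>x \<tau>\<bar> else 0)"
    by (rule sum.swap)
  also have "\<dots> \<le> (\<Sum>\<tau>\<in>?S. \<bar>x \<tau>\<bar>)"
  proof (rule sum_mono)
    fix \<tau>
    have "(\<Sum>\<sigma>\<in>?L. if \<tau> \<succeq> \<sigma> then \<bar>x \<tau>\<bar> else 0) = (\<Sum>\<sigma>\<in>{\<sigma>\<in>?L. \<tau> \<succeq> \<sigma>}. \<bar>x \<tau>\<bar>)"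
      by (simp add: sum.inter_filter[symmetric] finite_level)
    also have "\<dots> = real (card {\<sigma>\<in>?L. \<tau> \<succeq> \<sigma>}) * \<bar>x \<tau>\<bar>" by simp
    also have "\<dots> \<le> 1 * \<bar>x \<tau>\<bar>"
    proof (rule mult_right_mono)
      have "finite {\<sigma>\<in>?L. \<tau> \<succeq> \<sigma>}"
        by (rule finite_subset[OF _ finite_level[of n]]) auto
      then have "card {\<sigma>\<in>?L. \<tau> \<succeq> \<sigma>} \<le> Suc 0"
        by (subst card_le_Suc0_iff_eq) (auto intro: extends_same_level)
      then show "real (card {\<sigma>\<in>?L. \<tau> \<succeq> \<sigma>}) \<le> 1" by simp
    qed simp
    finally show "(\<Sum>\<sigma>\<in>?L. if \<tau> \<succeq> \<sigma> then \<bar>x \<tau>\<bar> else 0) \<le> \<bar>x \<tau>\<bar>" by simp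
  qed
  finally show ?thesis .
qed

lemma tree_norm_upper:
  assumes "finite {\<tau>. x \<tau> \<noteq> 0}" "n \<ge> 1"
  shows "level_norm x n \<le> tree_norm x"
  unfolding tree_norm_def
  by (rule cSUP_upper)
     (use assms level_norm_bound[OF assms(1)] in \<open>auto intro!: bdd_aboveI2\<close>)

lemma tree_norm_least:
  assumes "\<And>n. n \<ge> 1 \<Longrightarrow> level_norm x n \<le> b"
  shows "tree_norm x \<le> b"
  unfolding tree_norm_def by (rule cSUP_least) (use assms in auto)

lemma coord_le_tree_norm:
  assumes "finite {\<tau>. x \<tau> \<noteq> 0}"
  shows "\<bar>x \<tau>\<bar> \<le> tree_norm x"
proof -
  have "\<bar>x \<tau>\<bar> \<le> subtree_sup x \<tau>"
    by (rule subtree_sup_upper[OF assms extends_refl])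
  also have "\<dots> \<le> level_norm x (level \<tau>)"
    unfolding level_norm_L2 by (rule member_le_L2_set) (auto simp: finite_level)
  also have "\<dots> \<le> tree_norm x"
    by (rule tree_norm_upper[OF assms level_pos])
  finally show ?thesis .
qed

lemma tree_norm_nonneg: "finite {\<tau>. x \<tau> \<noteq> 0} \<Longrightarrow> 0 \<le> tree_norm x"
  using coord_le_tree_norm[of x "Abs_dyadic_tree [True]"] by linarith

lemma finite_support_add:
  fixes x y :: "dyadic_tree \<Rightarrow> real"
  assumes "finite {\<tau>. x \<tau> \<noteq> 0}" "finite {\<tau>. y \<tau> \<noteq> 0}"
  shows "finite {\<tau>. x \<tau> + y \<tau> \<noteq> 0}"
  by (rule finite_subset[of _ "{\<tau>. x \<tau> \<noteq> 0} \<union> {\<tau>. y \<tau> \<noteq> 0}"]) (use assms in auto)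

lemma tree_norm_triangle:
  assumes x: "finite {\<tau>. x \<tau> \<noteq> 0}" and y: "finite {\<tau>. y \<tau> \<noteq> 0}"
  shows "tree_norm (\<lambda>\<tau>. x \<tau> + y \<tau>) \<le> tree_norm x + tree_norm y"
proof (rule tree_norm_least)
  fix n :: nat assume n: "n \<ge> 1"
  let ?L = "{\<sigma>. level \<sigma> = n}"
  have "level_norm (\<lambda>\<tau>. x \<tau> + y \<tau>) n \<le> L2_set (\<lambda>\<sigma>. subtree_sup x \<sigma> + subtree_sup y \<sigma>) ?L"
    unfolding level_norm_L2
  proof (rule L2_set_mono)
    fix \<sigma>
    show "0 \<le> subtree_sup (\<lambda>\<tau>. x \<tau> + y \<tau>) \<sigma>"
      by (rule subtree_sup_nonneg[OF finite_support_add[OF x y]])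
    show "subtree_sup (\<lambda>\<tau>. x \<tau> + y \<tau>) \<sigma> \<le> subtree_sup x \<sigma> + subtree_sup y \<sigma>"
    proof (rule subtree_sup_least)
      fix \<tau> assume "\<tau> \<succeq> \<sigma>"
      then show "\<bar>x \<tau> + y \<tau>\<bar> \<le> subtree_sup x \<sigma> + subtree_sup y \<sigma>"
        using subtree_sup_upper[OF x, of \<tau> \<sigma>] subtree_sup_upper[OF y, of \<tau> \<sigma>] by linarith
    qed
  qed
  also have "\<dots> \<le> level_norm x n + level_norm y n"
    unfolding level_norm_L2 by (rule L2_set_triangle_ineq)
  also have "\<dots> \<le> tree_norm x + tree_norm y"
    by (intro add_mono tree_norm_upper x y n)
  finally show "level_norm (\<lambda>\<tau>. x \<tau> + y \<tau>) n \<le> tree_norm x + tree_norm y" .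
qed

lemma tree_norm_scale_le:
  assumes x: "finite {\<tau>. x \<tau> \<noteq> 0}"
  shows "tree_norm (\<lambda>\<tau>. c * x \<tau>) \<le> \<bar>c\<bar> * tree_norm x"
proof (rule tree_norm_least)
  fix n :: nat assume n: "n \<ge> 1"
  let ?L = "{\<sigma>. level \<sigma> = n}"
  have cx: "finite {\<tau>. c * x \<tau> \<noteq> 0}"
    by (rule finite_subset[OF _ x]) auto
  have "level_norm (\<lambda>\<tau>. c * x \<tau>) n \<le> L2_set (\<lambda>\<sigma>. \<bar>c\<bar> * subtree_sup x \<sigma>) ?L"
    unfolding level_norm_L2
  proof (rule L2_set_mono)
    fix \<sigma>
    show "0 \<le> subtree_sup (\<lambda>\<tau>. c * x \<tau>) \<sigma>" by (rule subtree_sup_nonneg[OF cx])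
    show "subtree_sup (\<lambda>\<tau>. c * x \<tau>) \<sigma> \<le> \<bar>c\<bar> * subtree_sup x \<sigma>"
      by (rule subtree_sup_least)
         (simp add: abs_mult mult_left_mono subtree_sup_upper[OF x])
  qed
  also have "\<dots> = \<bar>c\<bar> * level_norm x n"
    unfolding level_norm_L2 by (simp add: L2_set_right_distrib)
  also have "\<dots> \<le> \<bar>c\<bar> * tree_norm x"
    by (intro mult_left_mono tree_norm_upper x n) simp
  finally show "level_norm (\<lambda>\<tau>. c * x \<tau>) n \<le> \<bar>c\<bar> * tree_norm x" .
qed

lemma tree_norm_scale:
  assumes x: "finite {\<tau>. x \<tau> \<noteq> 0}"
  shows "tree_norm (\<lambda>\<tau>. c * x \<tau>) = \<bar>c\<bar> * tree_norm x"
proof (cases "c = 0")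
  case True
  then show ?thesis
    using tree_norm_scale_le[OF x, of 0] tree_norm_nonneg[of "\<lambda>_. 0"] by simp
next
  case False
  have cx: "finite {\<tau>. c * x \<tau> \<noteq> 0}" by (rule finite_subset[OF _ x]) auto
  have "(\<lambda>\<tau>. inverse c * (c * x \<tau>)) = x" using False by (simp add: field_simps)
  then have "tree_norm x \<le> \<bar>inverse c\<bar> * tree_norm (\<lambda>\<tau>. c * x \<tau>)"
    using tree_norm_scale_le[OF cx, of "inverse c"] by simp
  then have "\<bar>c\<bar> * tree_norm x \<le> tree_norm (\<lambda>\<tau>. c * x \<tau>)"
    using False by (simp add: field_simps)
  with tree_norm_scale_le[OF x, of c] show ?thesis by linarith
qed

instantiation c00_tree :: real_vector
begin

lift_definition zero_c00_tree :: c00_tree is "\<lambda>_. 0" by simp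

lift_definition plus_c00_tree :: "c00_tree \<Rightarrow> c00_tree \<Rightarrow> c00_tree" is "\<lambda>x y \<tau>. x \<tau> + y \<tau>"
  by (rule finite_support_add)

lift_definition uminus_c00_tree :: "c00_tree \<Rightarrow> c00_tree" is "\<lambda>x \<tau>. - x \<tau>" by simp

lift_definition minus_c00_tree :: "c00_tree \<Rightarrow> c00_tree \<Rightarrow> c00_tree" is "\<lambda>x y \<tau>. x \<tau> - y \<tau>"
proof -
  fix x y :: "dyadic_tree \<Rightarrow> real"
  assume "finite {\<tau>. x \<tau> \<noteq> 0}" "finite {\<tau>. y \<tau> \<noteq> 0}"
  then show "finite {\<tau>. x \<tau> - y \<tau> \<noteq> 0}"
    using finite_support_add[of x "\<lambda>\<tau>. - y \<tau>"] by simp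
qed

lift_definition scaleR_c00_tree :: "real \<Rightarrow> c00_tree \<Rightarrow> c00_tree" is "\<lambda>c x \<tau>. c * x \<tau>"
  by (rule rev_finite_subset) auto

instance
proof
  fix a b c :: c00_tree and r s :: real
  show "a + b + c = a + (b + c)" by transfer (simp add: add.assoc)
  show "a + b = b + a" by transfer (simp add: add.commute)
  show "0 + a = a" by transfer simp
  show "- a + a = 0" by transfer simp
  show "a - b = a + - b" by transfer simp
  show "r *\<^sub>R (a + b) = r *\<^sub>R a + r *\<^sub>R b" by transfer (simp add: distrib_left)
  show "(r + s) *\<^sub>R a = r *\<^sub>R a + s *\<^sub>R a" by transfer (simp add: distrib_right)
  show "r *\<^sub>R s *\<^sub>R a = (r * s) *\<^sub>R a" by transfer (simp add: mult.assoc)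
  show "1 *\<^sub>R a = a" by transfer simp
qed

end

instantiation c00_tree :: real_normed_vector
begin

lift_definition norm_c00_tree :: "c00_tree \<Rightarrow> real" is tree_norm .

definition dist_c00_tree :: "c00_tree \<Rightarrow> c00_tree \<Rightarrow> real" where
  "dist x y = norm (x - y :: c00_tree)"

definition sgn_c00_tree :: "c00_tree \<Rightarrow> c00_tree" where
  "sgn x = x /\<^sub>R norm (x :: c00_tree)"

definition uniformity_c00_tree :: "(c00_tree \<times> c00_tree) filter" where
  "uniformity_c00_tree = (INF e\<in>{0<..}. principal {(x, y :: c00_tree). dist x y < e})"

definition open_c00_tree :: "c00_tree set \<Rightarrow> bool" where
  "open_c00_tree U \<longleftrightarrow> (\<forall>x\<in>U. \<forall>\<^sub>F (x', y) in uniformity. x' = x \<longrightarrow> y \<in> U)"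

instance
proof
  fix a b :: c00_tree and r :: real and U :: "c00_tree set"
  show "dist a b = norm (a - b)" by (rule dist_c00_tree_def)
  show "sgn a = a /\<^sub>R norm a" by (rule sgn_c00_tree_def)
  show "(uniformity :: (c00_tree \<times> c00_tree) filter)
      = (INF e\<in>{0<..}. principal {(x, y). dist x y < e})"
    by (rule uniformity_c00_tree_def)
  show "open U \<longleftrightarrow> (\<forall>x\<in>U. \<forall>\<^sub>F (x', y) in uniformity. x' = x \<longrightarrow> y \<in> U)"
    by (rule open_c00_tree_def)
  show "norm a = 0 \<longleftrightarrow> a = 0"
  proof transfer
    fix x :: "dyadic_tree \<Rightarrow> real"
    assume x: "finite {\<tau>. x \<tau> \<noteq> 0}"
    show "tree_norm x = 0 \<longleftrightarrow> x = (\<lambda>_. 0)"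
      using coord_le_tree_norm[OF x] tree_norm_scale[OF x, of 0] by fastforce
  qed
  show "norm (a + b) \<le> norm a + norm b" by transfer (rule tree_norm_triangle)
  show "norm (r *\<^sub>R a) = \<bar>r\<bar> * norm a" by transfer (rule tree_norm_scale)
qed

end

type_synonym tree_space = "c00_tree banach_completion"


section \<open>Weak topologies\<close>

text \<open>The coarsest topology on \<open>S\<close> that makes every functional in \<open>D\<close> continuous. (It is used
  with \<open>0 \<in> D\<close>, so that the topological space is the whole of \<open>S\<close>.)\<close>

definition initial_topology :: "'a set \<Rightarrow> ('a \<Rightarrow> real) set \<Rightarrow> 'a topology" where
  "initial_topology S D = topology_generated_by {{x\<in>S. \<phi> x \<in> U} | \<phi> U. \<phi> \<in> D \<and> open U}"

definition weak_topology :: "'b::real_normed_vector topology" where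
  "weak_topology = initial_topology UNIV (range (blinfun_apply :: ('b \<Rightarrow>\<^sub>L real) \<Rightarrow> _))"

definition weakly_compact :: "'b::real_normed_vector set \<Rightarrow> bool" where
  "weakly_compact W \<longleftrightarrow> compactin weak_topology W"


section \<open>Lebesgue-Bochner spaces\<close>

text \<open>The library's Bochner integral requires a second countable range type, whereas these notions
  are needed for an arbitrary Banach space. The integral of the norm is taken as a nonnegative
  integral, since \<open>norm \<circ> f\<close> is only almost everywhere equal to a measurable function when \<open>M\<close> is
  not complete. \<open>M\<close> is meant to be a probability space throughout.\<close>

definition strongly_measurable :: "'a measure \<Rightarrow> ('a \<Rightarrow> 'b::real_normed_vector) \<Rightarrow> bool" where
  "strongly_measurable M f \<longleftrightarrow>
     (\<exists>s. (\<forall>i::nat. simple_function M (s i)) \<and> (AE x in M. (\<lambda>i. s i x) \<longlonglongrightarrow> f x))"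

definition bochner_integrable :: "'a measure \<Rightarrow> ('a \<Rightarrow> 'b::real_normed_vector) \<Rightarrow> bool" where
  "bochner_integrable M f \<longleftrightarrow>
     strongly_measurable M f \<and> (\<integral>\<^sup>+x. ennreal (norm (f x)) \<partial>M) < \<infinity>"

definition L1_norm :: "'a measure \<Rightarrow> ('a \<Rightarrow> 'b::real_normed_vector) \<Rightarrow> real" where
  "L1_norm M f = enn2real (\<integral>\<^sup>+x. ennreal (norm (f x)) \<partial>M)"

definition L1_class :: "'a measure \<Rightarrow> ('a \<Rightarrow> 'b::real_normed_vector) \<Rightarrow> ('a \<Rightarrow> 'b) set" where
  "L1_class M f = {g. bochner_integrable M g \<and> (AE x in M. f x = g x)}"

definition L1_space :: "'a measure \<Rightarrow> ('a \<Rightarrow> 'b::real_normed_vector) set set" where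
  "L1_space M = {L1_class M f | f. bochner_integrable M f}"

text \<open>The bounded linear functionals on \<open>L\<^sup>1(M, X)\<close>, whose elements are equivalence classes.\<close>

definition L1_dual :: "'a measure \<Rightarrow> (('a \<Rightarrow> 'b::real_normed_vector) set \<Rightarrow> real) set" where
  "L1_dual M = {\<phi>.
     (\<forall>f g. bochner_integrable M f \<and> bochner_integrable M g \<longrightarrow>
        \<phi> (L1_class M (\<lambda>x. f x + g x)) = \<phi> (L1_class M f) + \<phi> (L1_class M g)) \<and>
     (\<forall>c f. bochner_integrable M f \<longrightarrow>
        \<phi> (L1_class M (\<lambda>x. c *\<^sub>R f x)) = c * \<phi> (L1_class M f)) \<and>
     (\<exists>C. \<forall>f. bochner_integrable M f \<longrightarrow> \<bar>\<phi> (L1_class M f)\<bar> \<le> C * L1_norm M f)}"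

definition L1_weak_topology :: "'a measure \<Rightarrow> ('a \<Rightarrow> 'b::real_normed_vector) set topology" where
  "L1_weak_topology M = initial_topology (L1_space M) (L1_dual M)"

definition L1_relatively_weakly_compact ::
  "'a measure \<Rightarrow> ('a \<Rightarrow> 'b::real_normed_vector) set set \<Rightarrow> bool" where
  "L1_relatively_weakly_compact M K \<longleftrightarrow>
     K \<subseteq> L1_space M \<and> compactin (L1_weak_topology M) (L1_weak_topology M closure_of K)"

definition uniformly_integrable ::
  "'a measure \<Rightarrow> ('a \<Rightarrow> 'b::real_normed_vector) set set \<Rightarrow> bool" where
  "uniformly_integrable M K \<longleftrightarrow>
     (\<exists>C. \<forall>F\<in>K. \<forall>f\<in>F. L1_norm M f \<le> C) \<and>
     (\<forall>\<epsilon>>0. \<exists>\<delta>>0. \<forall>A\<in>sets M. measure M A \<le> \<delta> \<longrightarrow>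
        (\<forall>F\<in>K. \<forall>f\<in>F. (\<integral>\<^sup>+x\<in>A. ennreal (norm (f x)) \<partial>M) \<le> ennreal \<epsilon>))"

text \<open>Every class contains a Borel measurable representative, and the measure below is the same
  for all of them, because weakly compact sets are norm closed.\<close>

definition deltaS_set :: "'a measure \<Rightarrow> ('a \<Rightarrow> 'b::real_normed_vector) set set \<Rightarrow> bool" where
  "deltaS_set M K \<longleftrightarrow> K \<subseteq> L1_space M \<and> uniformly_integrable M K \<and>
     (\<forall>\<delta>>0. \<exists>W. weakly_compact W \<and>
        (\<forall>F\<in>K. \<forall>f\<in>F. f \<in> borel_measurable M \<longrightarrow> measure M (f -` W \<inter> space M) \<ge> 1 - \<delta>))"

definition property_deltaS :: "'a measure \<Rightarrow> 'b::banach itself \<Rightarrow> bool" where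
  "property_deltaS M X \<longleftrightarrow>
     (\<forall>K :: ('a \<Rightarrow> 'b) set set. L1_relatively_weakly_compact M K \<longrightarrow> deltaS_set M K)"

end

theory Submission
  imports Defs
begin

text \<open>
  Write \<open>e\<^sub>\<sigma>\<close> for the unit vectors of \<open>E\<close> and \<open>e\<^sub>\<sigma>\<^sup>*\<close> for the coordinate functionals. For a real \<open>s\<close>, let
  \<open>node n s\<close> be the word formed by the first \<open>n + 1\<close> binary digits of the fractional part of \<open>s\<close>; as
  \<open>n\<close> grows, these nodes run through a branch of the tree. The counterexample is the sequence
  \<open>f\<^sub>n(t) = e\<^sub>\<sigma>\<^sup>*\<close> with \<open>\<sigma> = node n ((n + 1) t)\<close>, whose set of classes in \<open>L\<^sup>1(\<lambda>, E\<^sup>*)\<close> is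
  relatively weakly compact but not a \<open>\<delta>\<S>\<close>-set.

  \<^emph>\<open>The sequence is weakly null.\<close> Fix a level \<open>k\<close>. If \<open>\<tau>\<^sub>i\<close> extends \<open>\<rho>\<^sub>i\<close> and all \<open>\<rho>\<^sub>i\<close> have level
  \<open>k\<close>, the Cauchy-Schwarz inequality over that level shows that the sum of the
  coordinate functionals at the nodes \<open>\<tau>\<^sub>i\<close> has a norm whose square is at most the number of pairs \<open>(i, j)\<close> with
  \<open>\<rho>\<^sub>i = \<rho>\<^sub>j\<close> (\<open>norm_sum_coord_functional_le\<close>). For \<open>i \<noteq> j\<close> the points \<open>(i + 1) t\<close> and \<open>(j + 1) t\<close> share
  their first \<open>k\<close> digits only if \<open>(i - j) t\<close> is within \<open>2\<^sup>-\<^sup>k\<close> of an integer, which happens on a set of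
  measure at most \<open>4 \<cdot> 2\<^sup>-\<^sup>k\<close>. Integrating, the average of any large number of the
  \<open>f\<^sub>n\<close> with \<open>n\<close> large is small in \<open>L\<^sup>1\<close>. A functional that stays away from \<open>0\<close> on a subsequence would
  stay away from \<open>0\<close> on its averages, so every functional tends to \<open>0\<close> along \<open>f\<^sub>n\<close>
  (\<open>L1_dual_tendsto_0_if_small_averages\<close>).

  \<^emph>\<open>The sequence is not a \<open>\<delta>\<S>\<close>-set.\<close> Suppose that \<open>W\<close> is weakly compact and \<open>f\<^sub>n \<in> W\<close> with probability
  at least \<open>1/2\<close> for every \<open>n\<close>. Dilation by \<open>n + 1\<close> modulo one preserves the measure, hence the set of
  \<open>s\<close> with \<open>e\<^sub>\<sigma>\<^sup>* \<in> W\<close> for \<open>\<sigma> = node n s\<close> has measure at least \<open>1/2\<close> too, and some \<open>s\<close>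
  belongs to infinitely many of these sets (\<open>exists_branch_infinitely_often\<close>). So \<open>W\<close> contains
  infinitely many coordinate functionals of one branch. But the unit vectors along a branch span a copy
  of \<open>c\<^sub>0\<close>, so summing the coordinates along it is a bounded functional on \<open>E\<^sup>*\<close>. It equals \<open>1\<close> at each
  of these coordinate functionals, while any weak cluster point of infinitely many of them has all
  branch coordinates equal to \<open>0\<close>. This contradicts weak compactness
  (\<open>finite_biorthogonal_in_weakly_compact\<close>).
\<close>


section \<open>Compactness in initial topologies\<close>

text \<open>Since \<open>D\<close> contains the zero function, \<open>S\<close> is itself one of the generating sets.\<close>

lemma topspace_initial_topology:
  assumes "(\<lambda>_. 0) \<in> D"
  shows "topspace (initial_topology S D) = S"
proof -
  have "S \<in> {{x\<in>S. \<phi> x \<in> U} | \<phi> U. \<phi> \<in> D \<and> open (U :: real set)}"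
    using assms by (intro CollectI exI[of _ "\<lambda>_. 0"] exI[of _ UNIV]) auto
  then show ?thesis
    unfolding initial_topology_def topology_generated_by_topspace by blast
qed

lemma openin_initial_topology:
  assumes "\<phi> \<in> D" "open U"
  shows "openin (initial_topology S D) {x\<in>S. \<phi> x \<in> U}"
  unfolding initial_topology_def
  by (rule topology_generated_by_Basis) (use assms in blast)

lemma openin_initial_topology_induct [consumes 1, case_names empty Int Union preimage]:
  assumes "openin (initial_topology S D) U"
    and "P {}"
    and "\<And>U V. P U \<Longrightarrow> P V \<Longrightarrow> P (U \<inter> V)"
    and "\<And>\<U>. (\<And>U. U \<in> \<U> \<Longrightarrow> P U) \<Longrightarrow> P (\<Union>\<U>)"
    and "\<And>\<phi> V. \<phi> \<in> D \<Longrightarrow> open V \<Longrightarrow> P {x\<in>S. \<phi> x \<in> V}"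
  shows "P U"
proof -
  have "generate_topology_on {{x\<in>S. \<phi> x \<in> U} | \<phi> U. \<phi> \<in> D \<and> open U} U"
    using assms(1) unfolding initial_topology_def by (rule openin_topology_generated_by)
  then show ?thesis
    by induction (use assms(2-5) in auto)
qed

lemma limitin_initial_topology:
  assumes D: "(\<lambda>_. 0) \<in> D" and "range F \<subseteq> S" "z \<in> S"
    and lim: "\<And>\<phi>. \<phi> \<in> D \<Longrightarrow> (\<lambda>n. \<phi> (F n)) \<longlonglongrightarrow> \<phi> z"
  shows "limitin (initial_topology S D) F z sequentially"
proof -
  have "z \<in> U \<longrightarrow> (\<forall>\<^sub>F n in sequentially. F n \<in> U)" if "openin (initial_topology S D) U" for U
    using that
  proof (induction rule: openin_initial_topology_induct)
    case (Union \<U>)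
    show ?case
    proof
      assume "z \<in> \<Union>\<U>"
      then obtain U where "U \<in> \<U>" "z \<in> U" by blast
      with Union have "\<forall>\<^sub>F n in sequentially. F n \<in> U" by blast
      then show "\<forall>\<^sub>F n in sequentially. F n \<in> \<Union>\<U>"
        by (rule eventually_mono) (use \<open>U \<in> \<U>\<close> in blast)
    qed
  next
    case (preimage \<phi> V)
    then show ?case
      using topological_tendstoD[OF lim, of \<phi> V] range_subsetD[OF assms(2)] by (auto elim!: eventually_mono)
  qed (auto intro: eventually_conj)
  then show ?thesis
    using assms(3) by (simp add: limitin_def topspace_initial_topology[OF D])
qed

text \<open>Functionals need not separate points here, so an initial topology is in general not Hausdorff.
  It is still regular, because the closed balls of the real line pull back to closed sets; regularity
  suffices for closures of compact sets to be compact.\<close>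

lemma regular_space_initial_topology:
  assumes D: "(\<lambda>_. 0) \<in> D"
  shows "regular_space (initial_topology S D)" (is "regular_space ?T")
proof -
  have "\<forall>x\<in>U. \<exists>V C. openin ?T V \<and> closedin ?T C \<and> x \<in> V \<and> V \<subseteq> C \<and> C \<subseteq> U" if "openin ?T U" for U
    using that
  proof (induction rule: openin_initial_topology_induct)
    case (Int U U')
    show ?case
    proof
      fix x assume "x \<in> U \<inter> U'"
      with Int obtain V C V' C' where
        "openin ?T V" "closedin ?T C" "x \<in> V" "V \<subseteq> C" "C \<subseteq> U"
        "openin ?T V'" "closedin ?T C'" "x \<in> V'" "V' \<subseteq> C'" "C' \<subseteq> U'" by (meson IntD1 IntD2)
      then show "\<exists>V C. openin ?T V \<and> closedin ?T C \<and> x \<in> V \<and> V \<subseteq> C \<and> C \<subseteq> U \<inter> U'"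
        by (intro exI[of _ "V \<inter> V'"] exI[of _ "C \<inter> C'"]) auto
    qed
  next
    case (Union \<U>)
    then show ?case by (meson Sup_upper UnionE order_trans)
  next
    case (preimage \<phi> U)
    show ?case
    proof
      fix x assume x: "x \<in> {x \<in> S. \<phi> x \<in> U}"
      then obtain r where r: "r > 0" "cball (\<phi> x) r \<subseteq> U"
        using preimage(2) open_contains_cball by blast
      let ?V = "{y\<in>S. \<phi> y \<in> ball (\<phi> x) r}" and ?C = "{y\<in>S. \<phi> y \<in> cball (\<phi> x) r}"
      have "?C = topspace ?T - {y\<in>S. \<phi> y \<in> - cball (\<phi> x) r}"
        by (auto simp: topspace_initial_topology[OF D])
      moreover have "closedin ?T (topspace ?T - {y\<in>S. \<phi> y \<in> - cball (\<phi> x) r})"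
        by (intro closedin_diff closedin_topspace openin_initial_topology preimage(1)) auto
      ultimately have "closedin ?T ?C" by simp
      moreover have "openin ?T ?V" by (rule openin_initial_topology[OF preimage(1) open_ball])
      moreover have "x \<in> ?V" using x r by simp
      moreover have "?V \<subseteq> ?C" by auto
      moreover have "?C \<subseteq> {x \<in> S. \<phi> x \<in> U}" using r by blast
      ultimately show "\<exists>V C. openin ?T V \<and> closedin ?T C \<and> x \<in> V \<and> V \<subseteq> C \<and> C \<subseteq> {x \<in> S. \<phi> x \<in> U}"
        by blast
    qed
  qed simp
  then show ?thesis
    by (auto simp: neighbourhood_base_of_closedin[symmetric] neighbourhood_base_of)
qed

text \<open>A finite union of open sets that covers the compact set can be separated from its complement,
  and hence covers the closure as well.\<close>

lemma compactin_closure_of_compactin: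
  assumes "regular_space X" "compactin X K"
  shows "compactin X (X closure_of K)"
  unfolding compactin_def
proof (intro conjI allI impI)
  show "X closure_of K \<subseteq> topspace X" by (rule closure_of_subset_topspace)
  fix \<U> assume \<U>: "Ball \<U> (openin X) \<and> X closure_of K \<subseteq> \<Union>\<U>"
  have "K \<subseteq> X closure_of K" by (rule closure_of_subset[OF compactin_subset_topspace[OF assms(2)]])
  with \<U> obtain \<F> where \<F>: "finite \<F>" "\<F> \<subseteq> \<U>" "K \<subseteq> \<Union>\<F>"
    using assms(2) unfolding compactin_def by (metis order_trans)
  have "openin X (\<Union>\<F>)" using \<U> \<F> by blast
  then have "closedin X (topspace X - \<Union>\<F>)" by blast
  moreover have "disjnt K (topspace X - \<Union>\<F>)" using \<F> by (auto simp: disjnt_def)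
  ultimately obtain V V' where V: "openin X V'" "K \<subseteq> V" "topspace X - \<Union>\<F> \<subseteq> V'" "disjnt V V'"
    using regular_space_compact_closed_separation[OF assms] by meson
  have "X closure_of K \<subseteq> topspace X - V'"
    by (rule closure_of_minimal)
       (use V compactin_subset_topspace[OF assms(2)] in \<open>auto simp: disjnt_def\<close>)
  then have "X closure_of K \<subseteq> \<Union>\<F>" using V by blast
  with \<F> show "\<exists>\<F>. finite \<F> \<and> \<F> \<subseteq> \<U> \<and> X closure_of K \<subseteq> \<Union>\<F>" by blast
qed

lemma compactin_closure_of_convergent_sequence:
  assumes "regular_space X" "limitin X F z sequentially" "range F \<subseteq> topspace X"
  shows "compactin X (X closure_of range F)"
proof (rule closed_compactin)
  show "compactin X (X closure_of insert z (range F))"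
    by (rule compactin_closure_of_compactin[OF assms(1)
          compactin_sequence_with_limit[OF assms(2) subset_refl assms(3)]])
qed (auto intro: closure_of_mono[THEN subsetD])


section \<open>Weakly unconditionally Cauchy series and weak compactness\<close>

text \<open>The hypothesis says that the series of the \<open>u n\<close> is weakly unconditionally Cauchy. Choosing the
  coefficients as the signs of \<open>v (u n)\<close> bounds the sum of \<open>\<bar>v (u n)\<bar>\<close> by \<open>B * norm v\<close>; so, although
  the series of the \<open>u n\<close> may diverge, it has a sum in the bidual.\<close>

lemma wuC_sum_functional:
  fixes u :: "nat \<Rightarrow> 'b::real_normed_vector"
  assumes wuC: "\<And>M (c :: nat \<Rightarrow> real). (\<And>n. \<bar>c n\<bar> \<le> 1) \<Longrightarrow> norm (\<Sum>n<M. c n *\<^sub>R u n) \<le> B"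
  obtains \<Phi> :: "('b \<Rightarrow>\<^sub>L real) \<Rightarrow>\<^sub>L real"
  where "\<And>v. (\<lambda>n. blinfun_apply v (u n)) sums blinfun_apply \<Phi> v"
proof -
  have partial: "(\<Sum>n<M. \<bar>blinfun_apply v (u n)\<bar>) \<le> norm v * B" for v :: "'b \<Rightarrow>\<^sub>L real" and M
  proof -
    let ?c = "\<lambda>n. sgn (blinfun_apply v (u n))"
    have "(\<Sum>n<M. \<bar>blinfun_apply v (u n)\<bar>) = blinfun_apply v (\<Sum>n<M. ?c n *\<^sub>R u n)"
      by (simp add: blinfun.sum_right blinfun.scaleR_right abs_sgn mult.commute)
    also have "\<dots> \<le> norm v * norm (\<Sum>n<M. ?c n *\<^sub>R u n)"
      using norm_blinfun[of v "\<Sum>n<M. ?c n *\<^sub>R u n"] by simp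
    also have "\<dots> \<le> norm v * B"
      by (intro mult_left_mono wuC) (auto simp: abs_sgn_eq)
    finally show ?thesis .
  qed
  have abs_summable: "summable (\<lambda>n. \<bar>blinfun_apply v (u n)\<bar>)" for v :: "'b \<Rightarrow>\<^sub>L real"
    by (rule summableI_nonneg_bounded[OF _ partial]) simp
  then have summable: "summable (\<lambda>n. blinfun_apply v (u n))" for v :: "'b \<Rightarrow>\<^sub>L real"
    by (rule summable_rabs_cancel)
  have "bounded_linear (\<lambda>v :: 'b \<Rightarrow>\<^sub>L real. \<Sum>n. blinfun_apply v (u n))"
  proof (rule bounded_linear_intro)
    fix v w :: "'b \<Rightarrow>\<^sub>L real" and r :: real
    show "(\<Sum>n. blinfun_apply (v + w) (u n)) = (\<Sum>n. blinfun_apply v (u n)) + (\<Sum>n. blinfun_apply w (u n))"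
      by (simp add: blinfun.add_left suminf_add summable)
    show "(\<Sum>n. blinfun_apply (r *\<^sub>R v) (u n)) = r *\<^sub>R (\<Sum>n. blinfun_apply v (u n))"
      by (simp add: blinfun.scaleR_left suminf_mult summable)
    have "\<bar>\<Sum>n. blinfun_apply v (u n)\<bar> \<le> (\<Sum>n. \<bar>blinfun_apply v (u n)\<bar>)"
      by (rule summable_rabs[OF abs_summable])
    also have "\<dots> \<le> norm v * B"
      by (rule suminf_le_const[OF abs_summable partial])
    finally show "norm (\<Sum>n. blinfun_apply v (u n)) \<le> norm v * B" by simp
  qed
  then show ?thesis
    by (intro that[of "Blinfun (\<lambda>v. \<Sum>n. blinfun_apply v (u n))"])
       (simp add: bounded_linear_Blinfun_apply summable_sums summable)
qed

text \<open>A functional that vanishes at every \<open>u n\<close> is mapped to \<open>0\<close> by the sum \<open>\<Phi>\<close> of the series in the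
  bidual. Hence the weakly open sets \<open>v (u n) \<noteq> 0\<close>, together with \<open>\<Phi> v < 1\<close>, cover the dual space. Each
  \<open>v n\<close> lies in exactly one of them, namely the \<open>n\<close>-th set of the first kind, so a finite
  subcover of \<open>W\<close> leaves room for only finitely many \<open>v n\<close>.\<close>

lemma finite_biorthogonal_in_weakly_compact:
  fixes u :: "nat \<Rightarrow> 'b::real_normed_vector" and v :: "nat \<Rightarrow> 'b \<Rightarrow>\<^sub>L real"
  assumes wuC: "\<And>M (c :: nat \<Rightarrow> real). (\<And>n. \<bar>c n\<bar> \<le> 1) \<Longrightarrow> norm (\<Sum>n<M. c n *\<^sub>R u n) \<le> B"
    and biorth: "\<And>m n. blinfun_apply (v m) (u n) = (if m = n then 1 else 0)"
    and W: "weakly_compact W"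
  shows "finite {n. v n \<in> W}"
proof -
  obtain \<Phi> :: "('b \<Rightarrow>\<^sub>L real) \<Rightarrow>\<^sub>L real"
    where \<Phi>: "\<And>w. (\<lambda>n. blinfun_apply w (u n)) sums blinfun_apply \<Phi> w"
    using wuC_sum_functional[OF wuC] by metis
  define U where "U n = {w :: 'b \<Rightarrow>\<^sub>L real. blinfun_apply w (u n) \<noteq> 0}" for n
  define U\<^sub>0 where "U\<^sub>0 = {w :: 'b \<Rightarrow>\<^sub>L real. blinfun_apply \<Phi> w < 1}"
  have U_open: "openin weak_topology (U n)" for n
  proof -
    have b: "bounded_linear (\<lambda>w :: 'b \<Rightarrow>\<^sub>L real. blinfun_apply w (u n))"
      by (rule blinfun.bounded_linear_left)
    have "openin weak_topology {w \<in> UNIV. blinfun_apply (Blinfun (\<lambda>w :: 'b \<Rightarrow>\<^sub>L real. blinfun_apply w (u n))) w \<in> - {0}}"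
      unfolding weak_topology_def by (intro openin_initial_topology) auto
    then show ?thesis by (simp add: U_def bounded_linear_Blinfun_apply[OF b])
  qed
  have U0_open: "openin weak_topology U\<^sub>0"
  proof -
    have "openin weak_topology {w \<in> UNIV. blinfun_apply \<Phi> w \<in> {..<1}}"
      unfolding weak_topology_def by (intro openin_initial_topology) auto
    then show ?thesis by (simp add: U\<^sub>0_def)
  qed
  have cover: "W \<subseteq> \<Union>(insert U\<^sub>0 (range U))"
  proof
    fix w
    have "blinfun_apply \<Phi> w = 0" if "\<And>n. blinfun_apply w (u n) = 0"
      using \<Phi>[of w] that by (simp add: sums_iff)
    then show "w \<in> \<Union>(insert U\<^sub>0 (range U))" by (force simp: U_def U\<^sub>0_def)
  qed
  obtain \<F> where \<F>: "finite \<F>" "\<F> \<subseteq> insert U\<^sub>0 (range U)" "W \<subseteq> \<Union>\<F>"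
    using W cover U_open U0_open unfolding weakly_compact_def compactin_def
    by (metis (no_types, lifting) insertE rangeE)
  obtain N where N: "finite N" "\<F> - {U\<^sub>0} = U ` N"
    using finite_subset_image[of "\<F> - {U\<^sub>0}" U UNIV] \<F> by blast
  have "n \<in> N" if "v n \<in> W" for n
  proof -
    have "(\<lambda>k. blinfun_apply (v n) (u k)) sums 1"
      using sums_single[of n "\<lambda>_. 1 :: real"] by (simp add: biorth eq_commute cong: if_cong)
    then have "blinfun_apply \<Phi> (v n) = 1" using \<Phi>[of "v n"] sums_unique2 by blast
    then have "v n \<notin> U\<^sub>0" by (simp add: U\<^sub>0_def)
    with that \<F> have "v n \<in> \<Union>(\<F> - {U\<^sub>0})" by blast
    then obtain m where "m \<in> N" "v n \<in> U m" unfolding N by blast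
    then show ?thesis by (auto simp: U_def biorth split: if_splits)
  qed
  then show ?thesis using N finite_subset[of "{n. v n \<in> W}" N] by blast
qed


section \<open>Weakly null sequences of simple functions\<close>

lemma simple_function_imp_bochner_integrable:
  fixes f :: "'a \<Rightarrow> 'b::real_normed_vector"
  assumes "finite_measure M" "simple_function M f"
  shows "bochner_integrable M f"
proof -
  have "finite ((\<lambda>x. norm (f x)) ` space M)"
    using simple_functionD(1)[OF simple_function_compose1[OF assms(2), of norm]] .
  then obtain C where C: "\<And>x. x \<in> space M \<Longrightarrow> norm (f x) \<le> C"
    by (metis imageI Max_ge)
  have "(\<integral>\<^sup>+x. ennreal (norm (f x)) \<partial>M) \<le> (\<integral>\<^sup>+x. ennreal C \<partial>M)"
    by (intro nn_integral_mono ennreal_leI C)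
  also have "\<dots> < \<infinity>"
    using finite_measure.emeasure_finite[OF assms(1), of "space M"]
    by (simp add: ennreal_mult_less_top top.not_eq_extremum)
  finally show ?thesis
    using assms(2) unfolding bochner_integrable_def strongly_measurable_def
    by (intro conjI exI[of _ "\<lambda>_. f"]) auto
qed

lemma L1_dual_sum:
  fixes f :: "'i \<Rightarrow> 'a \<Rightarrow> 'b::real_normed_vector"
  assumes "finite_measure M" "\<phi> \<in> L1_dual M" "\<And>i. i \<in> I \<Longrightarrow> simple_function M (f i)"
  shows "\<phi> (L1_class M (\<lambda>x. \<Sum>i\<in>I. f i x)) = (\<Sum>i\<in>I. \<phi> (L1_class M (f i)))"
proof -
  have add: "\<phi> (L1_class M (\<lambda>x. f x + g x)) = \<phi> (L1_class M f) + \<phi> (L1_class M g)"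
    if "simple_function M f" "simple_function M g" for f g :: "'a \<Rightarrow> 'b"
    using assms(2) that[THEN simple_function_imp_bochner_integrable[OF assms(1)]]
    by (auto simp: L1_dual_def)
  have zero: "\<phi> (L1_class M (\<lambda>_. 0)) = 0"
    using add[of "\<lambda>_. 0" "\<lambda>_. 0"] by simp
  show ?thesis
    using assms(3)
    by (induction I rule: infinite_finite_induct) (simp_all add: zero add)
qed

text \<open>If a functional exceeded \<open>\<epsilon>\<close> in absolute value at infinitely many \<open>f n\<close>, then it would do so with
  a constant sign \<open>c\<close>, and \<open>N\<close> of these functions with large indices would have an average on which
  the functional still exceeds \<open>\<epsilon>\<close> in absolute value, although that average is small in norm.\<close>

lemma L1_dual_tendsto_0_if_small_averages:
  fixes f :: "nat \<Rightarrow> 'a \<Rightarrow> 'b::real_normed_vector"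
  assumes fin: "finite_measure M" and simple: "\<And>n. simple_function M (f n)"
    and small: "\<And>\<eta>. \<eta> > 0 \<Longrightarrow> \<exists>k N. N > 0 \<and> (\<forall>I\<subseteq>{k..}. card I = N \<longrightarrow>
                  L1_norm M (\<lambda>x. \<Sum>i\<in>I. f i x) \<le> \<eta> * real N)"
    and \<phi>: "\<phi> \<in> L1_dual M"
  shows "(\<lambda>n. \<phi> (L1_class M (f n))) \<longlonglongrightarrow> 0"
proof (rule LIMSEQ_I)
  fix \<epsilon> :: real assume \<epsilon>: "\<epsilon> > 0"
  obtain C where C: "\<And>g. bochner_integrable M g \<Longrightarrow> \<bar>\<phi> (L1_class M g)\<bar> \<le> C * L1_norm M g"
    using \<phi> unfolding L1_dual_def by blast
  define a where "a n = \<phi> (L1_class M (f n))" for n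
  define \<eta> where "\<eta> = \<epsilon> / (2 * (\<bar>C\<bar> + 1))"
  have "\<bar>C\<bar> + 1 > 0" by simp
  with \<epsilon> have \<eta>: "\<eta> > 0" "(\<bar>C\<bar> + 1) * \<eta> = \<epsilon> / 2"
    unfolding \<eta>_def by (auto simp del: distrib_left_numeral)
  obtain k N where N: "N > 0" and kN: "\<And>I. I \<subseteq> {k..} \<Longrightarrow> card I = N \<Longrightarrow>
      L1_norm M (\<lambda>x. \<Sum>i\<in>I. f i x) \<le> \<eta> * N"
    using small[OF \<eta>(1)] by blast
  have finite_sign: "finite {n. \<epsilon> \<le> c * a n}" if c: "\<bar>c\<bar> = 1" for c
  proof (rule ccontr)
    assume "infinite {n. \<epsilon> \<le> c * a n}"
    then have "infinite ({n. \<epsilon> \<le> c * a n} - {..<k})" by simp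
    then obtain I where I: "finite I" "card I = N" "I \<subseteq> {n. \<epsilon> \<le> c * a n} - {..<k}"
      using infinite_arbitrarily_large by metis
    then have avg: "L1_norm M (\<lambda>x. \<Sum>i\<in>I. f i x) \<le> \<eta> * N"
      by (intro kN) auto
    have "N * \<epsilon> = (\<Sum>n\<in>I. \<epsilon>)" using I by simp
    also have "\<dots> \<le> (\<Sum>n\<in>I. c * a n)" using I by (intro sum_mono) auto
    also have "\<dots> = c * \<phi> (L1_class M (\<lambda>x. \<Sum>i\<in>I. f i x))"
      by (simp add: a_def L1_dual_sum[OF fin \<phi> simple] sum_distrib_left)
    also have "\<dots> \<le> \<bar>\<phi> (L1_class M (\<lambda>x. \<Sum>i\<in>I. f i x))\<bar>"
      using c by (metis abs_ge_self abs_mult mult_1)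
    also have "\<dots> \<le> C * L1_norm M (\<lambda>x. \<Sum>i\<in>I. f i x)"
      by (intro C simple_function_imp_bochner_integrable[OF fin] simple_function_sum simple)
    also have "\<dots> \<le> (\<bar>C\<bar> + 1) * L1_norm M (\<lambda>x. \<Sum>i\<in>I. f i x)"
      by (intro mult_right_mono) (auto simp: L1_norm_def)
    also have "\<dots> \<le> (\<bar>C\<bar> + 1) * (\<eta> * N)"
      by (intro mult_left_mono avg) auto
    also have "\<dots> = N * (\<epsilon> / 2)" using \<eta>(2) by (simp add: mult.assoc[symmetric])
    finally show False using N \<epsilon> by simp
  qed
  have "{n. \<epsilon> \<le> \<bar>a n\<bar>} \<subseteq> {n. \<epsilon> \<le> 1 * a n} \<union> {n. \<epsilon> \<le> -1 * a n}" by auto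
  then have "finite {n. \<epsilon> \<le> \<bar>a n\<bar>}" using finite_sign[of 1] finite_sign[of "-1"] finite_subset by fastforce
  then have "\<exists>m. \<forall>n\<in>{n. \<epsilon> \<le> \<bar>a n\<bar>}. n < m" by (simp add: finite_nat_set_iff_bounded)
  then show "\<exists>m. \<forall>n\<ge>m. norm (\<phi> (L1_class M (f n)) - 0) < \<epsilon>"
    unfolding a_def by (metis diff_zero linorder_not_less mem_Collect_eq real_norm_def)
qed

lemma zero_in_L1_dual: "(\<lambda>_. 0) \<in> L1_dual M"
  unfolding L1_dual_def by (auto intro!: exI[of _ 0])

lemma L1_relatively_weakly_compact_if_small_averages:
  fixes f :: "nat \<Rightarrow> 'a \<Rightarrow> 'b::real_normed_vector"
  assumes fin: "finite_measure M" and simple: "\<And>n. simple_function M (f n)"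
    and small: "\<And>\<eta>. \<eta> > 0 \<Longrightarrow> \<exists>k N. N > 0 \<and> (\<forall>I\<subseteq>{k..}. card I = N \<longrightarrow>
                  L1_norm M (\<lambda>x. \<Sum>i\<in>I. f i x) \<le> \<eta> * real N)"
  shows "L1_relatively_weakly_compact M (range (\<lambda>n. L1_class M (f n)))"
proof -
  have in_space: "L1_class M g \<in> L1_space M" if "simple_function M g" for g :: "'a \<Rightarrow> 'b"
    using simple_function_imp_bochner_integrable[OF fin that] by (auto simp: L1_space_def)
  let ?z = "L1_class M (\<lambda>_. 0) :: ('a \<Rightarrow> 'b) set"
  have "(\<lambda>n. \<phi> (L1_class M (f n))) \<longlonglongrightarrow> \<phi> ?z" if "\<phi> \<in> L1_dual M" for \<phi>
    using L1_dual_sum[OF fin that, of "{}"] L1_dual_tendsto_0_if_small_averages[OF fin simple small that]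
    by simp
  then have "limitin (L1_weak_topology M) (\<lambda>n. L1_class M (f n)) ?z sequentially"
    unfolding L1_weak_topology_def
    by (intro limitin_initial_topology zero_in_L1_dual) (auto intro: in_space simple)
  moreover have "range (\<lambda>n. L1_class M (f n)) \<subseteq> L1_space M"
    using in_space simple by blast
  ultimately show ?thesis
    using compactin_closure_of_convergent_sequence[of "L1_weak_topology M"]
    unfolding L1_relatively_weakly_compact_def
    by (simp add: L1_weak_topology_def regular_space_initial_topology zero_in_L1_dual
        topspace_initial_topology)
qed


section \<open>Functionals on a completion\<close>

lift_definition completion_extend :: "('a::real_normed_vector \<Rightarrow>\<^sub>L real) \<Rightarrow> 'a banach_completion \<Rightarrow> real"
  is "\<lambda>f X. lim (\<lambda>n. blinfun_apply f (X n))"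
proof -
  fix f :: "'a \<Rightarrow>\<^sub>L real" and X Y :: "nat \<Rightarrow> 'a"
  assume XY: "cauchy_eq X Y"
  then have "convergent (\<lambda>n. blinfun_apply f (X n))" 
    using bounded_linear.Cauchy[OF blinfun.bounded_linear_right[of f]]
    by (auto simp: cauchy_eq_def intro!: Cauchy_convergent)
  then have lim: "(\<lambda>n. blinfun_apply f (X n)) \<longlonglongrightarrow> lim (\<lambda>n. blinfun_apply f (X n))"
    by (simp add: convergent_LIMSEQ_iff)
  have "(\<lambda>n. blinfun_apply f (X n - Y n)) \<longlonglongrightarrow> blinfun_apply f 0"
    using XY by (intro blinfun.tendsto tendsto_const) (simp add: cauchy_eq_def)
  with lim have "(\<lambda>n. blinfun_apply f (Y n)) \<longlonglongrightarrow> lim (\<lambda>n. blinfun_apply f (X n))"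
    using tendsto_diff[of "\<lambda>n. blinfun_apply f (X n)" _ _ "\<lambda>n. blinfun_apply f (X n - Y n)"]
    by (fastforce simp: blinfun.diff_right)
  then show "lim (\<lambda>n. blinfun_apply f (X n)) = lim (\<lambda>n. blinfun_apply f (Y n))"
    by (simp add: limI)
qed

lemma completion_extend_embed [simp]: "completion_extend f (completion_embed x) = blinfun_apply f x"
  by transfer simp

lemma completion_limit_of_embedded:
  fixes x :: "'a::real_normed_vector banach_completion"
  obtains X where "(\<lambda>n. completion_embed (X n)) \<longlonglongrightarrow> x"
  using banach_completion_cases completion_embed_tendsto by metis

lemma completion_extend_tendsto:
  assumes "Cauchy X"
  shows "(\<lambda>n. blinfun_apply f (X n)) \<longlonglongrightarrow> completion_extend f (abs_banach_completion X)"
proof -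
  have "convergent (\<lambda>n. blinfun_apply f (X n))"
    by (intro Cauchy_convergent bounded_linear.Cauchy[OF blinfun.bounded_linear_right assms])
  moreover have "completion_extend f (abs_banach_completion X) = lim (\<lambda>n. blinfun_apply f (X n))"
    by (rule completion_extend.abs_eq) (simp add: cauchy_eq_refl assms)
  ultimately show ?thesis by (simp add: convergent_LIMSEQ_iff)
qed

lemma bounded_linear_completion_extend: "bounded_linear (completion_extend f)"
proof (rule bounded_linear_intro)
  fix x y :: "'a banach_completion" and r :: real
  obtain X Y :: "nat \<Rightarrow> 'a" where X: "Cauchy X" "x = abs_banach_completion X"
    and Y: "Cauchy Y" "y = abs_banach_completion Y"
    by (metis banach_completion_cases)
  note lX = completion_extend_tendsto[OF X(1), of f, folded X(2)]
  note lY = completion_extend_tendsto[OF Y(1), of f, folded Y(2)]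
  have "x + y = abs_banach_completion (\<lambda>n. X n + Y n)"
    unfolding X(2) Y(2) by (rule plus_banach_completion.abs_eq) (simp_all add: cauchy_eq_refl X Y)
  then have "(\<lambda>n. blinfun_apply f (X n + Y n)) \<longlonglongrightarrow> completion_extend f (x + y)"
    using completion_extend_tendsto[OF Cauchy_add_seq[OF X(1) Y(1)], of f] by simp
  then show "completion_extend f (x + y) = completion_extend f x + completion_extend f y"
    using LIMSEQ_unique[OF _ tendsto_add[OF lX lY]] by (simp add: blinfun.add_right)
  have "r *\<^sub>R x = abs_banach_completion (\<lambda>n. r *\<^sub>R X n)"
    unfolding X(2) by (rule scaleR_banach_completion.abs_eq) (simp_all add: cauchy_eq_refl X)
  then have "(\<lambda>n. blinfun_apply f (r *\<^sub>R X n)) \<longlonglongrightarrow> completion_extend f (r *\<^sub>R x)"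
    using completion_extend_tendsto[OF Cauchy_scaleR_seq[OF X(1)], of f r] by simp
  then show "completion_extend f (r *\<^sub>R x) = r *\<^sub>R completion_extend f x"
    using LIMSEQ_unique[OF _ tendsto_scaleR[OF tendsto_const lX]] by (simp add: blinfun.scaleR_right)
  have "(\<lambda>n. norm (X n)) \<longlonglongrightarrow> norm x"
    using tendsto_norm[OF completion_embed_tendsto[OF X(1)]] X(2) by (simp add: norm_completion_embed)
  then show "norm (completion_extend f x) \<le> norm x * norm f"
    by (intro LIMSEQ_le[OF tendsto_norm[OF lX] tendsto_mult_right])
       (use norm_blinfun[of f "X _"] in \<open>auto simp only: mult.commute[of _ "norm f"]\<close>)
qed

lemma norm_blinfun_completion_le:
  fixes v :: "'a::real_normed_vector banach_completion \<Rightarrow>\<^sub>L real"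
  assumes "\<And>a. \<bar>blinfun_apply v (completion_embed a)\<bar> \<le> B * norm a" "0 \<le> B"
  shows "norm v \<le> B"
proof (rule norm_blinfun_bound[OF assms(2)])
  fix x :: "'a banach_completion"
  obtain X :: "nat \<Rightarrow> 'a" where X: "(\<lambda>n. completion_embed (X n)) \<longlonglongrightarrow> x" by (rule completion_limit_of_embedded)
  have "(\<lambda>n. norm (blinfun_apply v (completion_embed (X n)))) \<longlonglongrightarrow> norm (blinfun_apply v x)"
    by (intro tendsto_norm blinfun.tendsto tendsto_const X)
  moreover have "(\<lambda>n. B * norm (completion_embed (X n))) \<longlonglongrightarrow> B * norm x"
    by (intro tendsto_mult tendsto_const tendsto_norm X)
  ultimately show "norm (blinfun_apply v x) \<le> B * norm x"
    by (rule LIMSEQ_le) (use assms(1) in \<open>simp add: norm_completion_embed\<close>)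
qed


section \<open>Branches of the dyadic tree\<close>

text \<open>The parity of \<open>\<lfloor>2\<^sup>j\<^sup>+\<^sup>1 s\<rfloor>\<close> is binary digit number \<open>j + 1\<close> of the fractional part of \<open>s\<close>, so \<open>node n s\<close>
  depends only on \<open>s\<close> modulo one. Words are never empty, hence \<open>n + 1\<close> digits.\<close>

definition node :: "nat \<Rightarrow> real \<Rightarrow> dyadic_tree" where
  "node n s = Abs_dyadic_tree (map (\<lambda>j. odd \<lfloor>2 ^ Suc j * s\<rfloor>) [0..<Suc n])"

lemma word_of_node: "word_of (node n s) = map (\<lambda>j. odd \<lfloor>2 ^ Suc j * s\<rfloor>) [0..<Suc n]"
  unfolding node_def by (rule Abs_dyadic_tree_inverse) simp

lemma node_eq_iff: "node n s = \<sigma> \<longleftrightarrow> 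
    length (word_of \<sigma>) = Suc n \<and> (\<forall>j\<le>n. word_of \<sigma> ! j = odd \<lfloor>2 ^ Suc j * s\<rfloor>)"
  unfolding word_of_inject[symmetric] word_of_node
  by (auto simp: list_eq_iff_nth_eq less_Suc_eq_le simp del: upt_Suc power_Suc)

lemma level_node [simp]: "level (node n s) = Suc n"
  by (simp add: level_def word_of_node)

lemma node_inject [simp]: "node m s = node n s \<longleftrightarrow> m = n"
  using level_node by (metis nat.inject)

lemma node_extends_node:
  assumes "m \<le> n" shows "node n s \<succeq> node m s"
proof -
  have "[0..<Suc n] = [0..<Suc m] @ [Suc m..<Suc n]"
    using assms by (metis Suc_le_mono le_add_diff_inverse upt_add_eq_append zero_le)
  then show ?thesis by (simp add: extends_def word_of_node del: upt_Suc)
qed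

lemma node_extends_iff: "node n s \<succeq> \<sigma> \<longleftrightarrow> (\<exists>m\<le>n. \<sigma> = node m s)"
proof
  assume *: "node n s \<succeq> \<sigma>"
  obtain m where m: "level \<sigma> = Suc m" using level_pos[of \<sigma>] by (cases "level \<sigma>") auto
  with * have "m \<le> n"
    using prefix_length_le[of "word_of \<sigma>" "word_of (node n s)"] level_node[of n s]
    unfolding level_def extends_def by simp
  with * m show "\<exists>m\<le>n. \<sigma> = node m s"
    using extends_same_level[OF * node_extends_node] by auto
qed (auto intro: node_extends_node)

lemma node_add_int [simp]: "node n (s + of_int p) = node n s"
proof -
  have "\<lfloor>2 ^ Suc j * (s + of_int p)\<rfloor> = \<lfloor>2 ^ Suc j * s\<rfloor> + 2 ^ Suc j * p" for j
  proof -
    have "2 ^ Suc j * (s + of_int p) = 2 ^ Suc j * s + of_int (2 ^ Suc j * p)"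
      by (simp add: distrib_left)
    then show ?thesis by (simp only: floor_add_int)
  qed
  then show ?thesis unfolding node_def by simp
qed

text \<open>Halving drops the last digit: \<open>\<lfloor>2\<^sup>m x\<rfloor>\<close> is \<open>\<lfloor>2\<^sup>m\<^sup>+\<^sup>1 x\<rfloor> div 2\<close>. So each further common digit
  doubles the difference of the two floors.\<close>

lemma dvd_floor_diff:
  fixes s t :: real
  assumes "\<And>j. j < m \<Longrightarrow> odd \<lfloor>2 ^ Suc j * s\<rfloor> = odd \<lfloor>2 ^ Suc j * t\<rfloor>"
  shows "2 ^ m dvd \<lfloor>2 ^ m * s\<rfloor> - \<lfloor>2 ^ m * t\<rfloor>"
  using assms
proof (induction m)
  case (Suc m)
  have half: "\<lfloor>2 ^ m * x\<rfloor> = \<lfloor>2 ^ Suc m * x\<rfloor> div 2" for x :: real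
    using floor_divide_real_eq_div[of 2 "2 ^ Suc m * x"] by simp
  have "odd \<lfloor>2 ^ Suc m * s\<rfloor> = odd \<lfloor>2 ^ Suc m * t\<rfloor>" using Suc.prems by blast
  then have "\<lfloor>2 ^ Suc m * s\<rfloor> - \<lfloor>2 ^ Suc m * t\<rfloor> = 2 * (\<lfloor>2 ^ m * s\<rfloor> - \<lfloor>2 ^ m * t\<rfloor>)"
    unfolding half by presburger
  moreover have "2 ^ m dvd \<lfloor>2 ^ m * s\<rfloor> - \<lfloor>2 ^ m * t\<rfloor>" using Suc by simp
  ultimately show ?case by (metis mult_dvd_mono dvd_refl power_Suc)
qed simp

lemma node_eq_imp_close_mod_1:
  assumes "node n s = node n t"
  shows "\<exists>p::int. \<bar>s - t - of_int p\<bar> < 1 / 2 ^ Suc n"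
proof -
  have "2 ^ Suc n dvd \<lfloor>2 ^ Suc n * s\<rfloor> - \<lfloor>2 ^ Suc n * t\<rfloor>"
  proof (rule dvd_floor_diff)
    fix j assume "j < Suc n"
    then show "odd \<lfloor>2 ^ Suc j * s\<rfloor> = odd \<lfloor>2 ^ Suc j * t\<rfloor>"
      using assms node_eq_iff[of n s "node n s"] node_eq_iff[of n t "node n s"] by (metis less_Suc_eq_le)
  qed
  then obtain p where "\<lfloor>2 ^ Suc n * s\<rfloor> - \<lfloor>2 ^ Suc n * t\<rfloor> = 2 ^ Suc n * p" by (rule dvdE)
  then have "real_of_int \<lfloor>2 ^ Suc n * s\<rfloor> - real_of_int \<lfloor>2 ^ Suc n * t\<rfloor> = 2 ^ Suc n * of_int p"
    by (metis of_int_diff of_int_mult of_int_numeral of_int_power)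
  moreover have "2 ^ Suc n * (s - t - of_int p) = 2 ^ Suc n * s - 2 ^ Suc n * t - 2 ^ Suc n * of_int p"
    by (simp add: right_diff_distrib)
  ultimately have "\<bar>2 ^ Suc n * (s - t - of_int p)\<bar> < 1" by linarith
  then have "2 ^ Suc n * \<bar>s - t - of_int p\<bar> < 1"
    unfolding abs_mult by simp
  then have "\<bar>s - t - of_int p\<bar> < 1 / 2 ^ Suc n"
    by (simp only: pos_less_divide_eq zero_less_power zero_less_numeral mult.commute)
  then show ?thesis ..
qed

lemma sets_node_eq: "{s. node n (c * s) = \<sigma>} \<in> sets borel"
  unfolding node_eq_iff by measurable


section \<open>Coordinate functionals on the tree space\<close>

lift_definition basis_vector :: "dyadic_tree \<Rightarrow> c00_tree" is "\<lambda>\<sigma> \<tau>. if \<tau> = \<sigma> then 1 else 0"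
  by simp

lemma coord_sum: "coord (\<Sum>i\<in>I. x i) \<tau> = (\<Sum>i\<in>I. coord (x i) \<tau>)"
  by (induction I rule: infinite_finite_induct) (simp_all add: zero_c00_tree.rep_eq plus_c00_tree.rep_eq)

lemma finite_coord: "finite {\<tau>. coord x \<tau> \<noteq> 0}"
  using coord[of x] by simp

lemma bounded_linear_coord: "bounded_linear (\<lambda>x. coord x \<sigma>)"
proof (rule bounded_linear_intro[where K = 1])
  show "norm (coord x \<sigma>) \<le> norm x * 1" for x
    using coord_le_tree_norm[OF finite_coord] by (simp add: norm_c00_tree.rep_eq)
qed (simp_all add: plus_c00_tree.rep_eq scaleR_c00_tree.rep_eq)

definition coord_functional :: "dyadic_tree \<Rightarrow> tree_space \<Rightarrow>\<^sub>L real" where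
  "coord_functional \<sigma> = Blinfun (completion_extend (Blinfun (\<lambda>x. coord x \<sigma>)))"

lemma coord_functional_embed [simp]:
  "blinfun_apply (coord_functional \<sigma>) (completion_embed x) = coord x \<sigma>"
  by (simp add: coord_functional_def bounded_linear_Blinfun_apply
      bounded_linear_completion_extend bounded_linear_coord)

text \<open>Bounding each coordinate at \<open>\<tau> i\<close> by the supremum over the subtree of \<open>r i\<close> and grouping
  the indices by the value \<open>\<sigma>\<close> of \<open>r i\<close>, with \<open>N \<sigma>\<close> indices in the group of \<open>\<sigma>\<close>, leaves
  a sum of products over one level. By the Cauchy-Schwarz inequality it is at most the Euclidean norm of \<open>N\<close>
  times the level norm, and the square of the former counts the pairs of indices in a common group.\<close>

lemma norm_sum_coord_functional_le:
  assumes "finite I" "k \<ge> 1"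
    and r: "\<And>i. i \<in> I \<Longrightarrow> \<tau> i \<succeq> r i" "\<And>i. i \<in> I \<Longrightarrow> level (r i) = k"
  shows "(norm (\<Sum>i\<in>I. coord_functional (\<tau> i)))\<^sup>2 \<le> (\<Sum>i\<in>I. \<Sum>j\<in>I. of_bool (r i = r j))"
proof -
  define L where "L = {\<sigma>. level \<sigma> = k}"
  define N :: "dyadic_tree \<Rightarrow> real" where "N \<sigma> = (\<Sum>i\<in>I. of_bool (r i = \<sigma>))" for \<sigma>
  have L: "finite L" "\<And>i. i \<in> I \<Longrightarrow> r i \<in> L" using finite_level r by (auto simp: L_def)
  have delta: "(\<Sum>\<sigma>\<in>L. of_bool (r i = \<sigma>) * h \<sigma>) = h (r i)" if "i \<in> I" for i and h :: "dyadic_tree \<Rightarrow> real"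
    using L that by (simp add: of_bool_def if_distrib[of "\<lambda>x. x * _"] cong: if_cong)
  have "(\<Sum>\<sigma>\<in>L. N \<sigma> * N \<sigma>) = (\<Sum>\<sigma>\<in>L. \<Sum>i\<in>I. of_bool (r i = \<sigma>) * N \<sigma>)"
    by (simp add: N_def sum_distrib_right)
  also have "\<dots> = (\<Sum>i\<in>I. \<Sum>\<sigma>\<in>L. of_bool (r i = \<sigma>) * N \<sigma>)" by (rule sum.swap)
  also have "\<dots> = (\<Sum>i\<in>I. N (r i))" by (intro sum.cong refl delta)
  also have "\<dots> = (\<Sum>i\<in>I. \<Sum>j\<in>I. of_bool (r i = r j))" by (simp add: N_def eq_commute)
  finally have N2: "(L2_set N L)\<^sup>2 = (\<Sum>i\<in>I. \<Sum>j\<in>I. of_bool (r i = r j))"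
    by (simp add: L2_set_def sum_nonneg power2_eq_square)
  have "norm (\<Sum>i\<in>I. coord_functional (\<tau> i)) \<le> L2_set N L"
  proof (rule norm_blinfun_completion_le)
    fix a :: c00_tree
    let ?S = "subtree_sup (coord a)"
    have "\<bar>blinfun_apply (\<Sum>i\<in>I. coord_functional (\<tau> i)) (completion_embed a)\<bar> = \<bar>\<Sum>i\<in>I. coord a (\<tau> i)\<bar>"
      by (simp add: blinfun.sum_left)
    also have "\<dots> \<le> (\<Sum>i\<in>I. ?S (r i))"
      by (rule order_trans[OF sum_abs]) (intro sum_mono subtree_sup_upper[OF finite_coord] r)
    also have "\<dots> = (\<Sum>i\<in>I. \<Sum>\<sigma>\<in>L. of_bool (r i = \<sigma>) * ?S \<sigma>)"
      by (intro sum.cong refl delta[symmetric])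
    also have "\<dots> = (\<Sum>\<sigma>\<in>L. \<bar>N \<sigma>\<bar> * \<bar>?S \<sigma>\<bar>)"
      by (subst sum.swap)
         (simp add: N_def sum_distrib_right sum_nonneg subtree_sup_nonneg[OF finite_coord])
    also have "\<dots> \<le> L2_set N L * L2_set ?S L" by (rule L2_set_mult_ineq)
    also have "L2_set ?S L \<le> norm a"
      using tree_norm_upper[OF finite_coord assms(2), of a]
      by (simp add: norm_c00_tree.rep_eq level_norm_L2 L_def)
    finally show "\<bar>blinfun_apply (\<Sum>i\<in>I. coord_functional (\<tau> i)) (completion_embed a)\<bar> \<le> L2_set N L * norm a"
      by (simp add: mult_left_mono)
  qed simp
  then show ?thesis unfolding N2[symmetric] by (intro power_mono) auto
qed

text \<open>At each level only one node lies on the branch, so each level norm of a vector supported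
  by the branch is a single supremum: the unit vectors of a branch behave like those of \<open>c\<^sub>0\<close>.\<close>

lemma norm_branch_sum_le:
  assumes c: "\<And>n. \<bar>c n\<bar> \<le> 1"
  shows "norm (\<Sum>n<M. c n *\<^sub>R completion_embed (basis_vector (node n s))) \<le> 1"
proof -
  define a where "a = (\<Sum>n<M. c n *\<^sub>R basis_vector (node n s))"
  have coord_a: "coord a \<tau> = (\<Sum>n<M. c n * of_bool (\<tau> = node n s))" for \<tau>
    by (simp add: a_def coord_sum scaleR_c00_tree.rep_eq basis_vector.rep_eq of_bool_def)
  have on: "\<bar>coord a (node m s)\<bar> \<le> 1" for m
    using c by (simp add: coord_a of_bool_def if_distrib[of "\<lambda>x. _ * x"] cong: if_cong)
  have off: "coord a \<tau> = 0" if "\<tau> \<notin> range (\<lambda>m. node m s)" for \<tau>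
    unfolding coord_a using that by (intro sum.neutral) auto
  have "norm a \<le> 1"
    unfolding norm_c00_tree.rep_eq
  proof (rule tree_norm_least)
    fix n :: nat assume "n \<ge> 1"
    let ?L = "{\<sigma>. level \<sigma> = n}"
    have "level_norm (coord a) n \<le> (\<Sum>\<sigma>\<in>?L. subtree_sup (coord a) \<sigma>)"
      unfolding level_norm_L2 by (intro L2_set_le_sum subtree_sup_nonneg finite_coord)
    also have "\<dots> \<le> (\<Sum>\<sigma>\<in>?L. of_bool (\<sigma> = node (n - 1) s))"
    proof (intro sum_mono subtree_sup_least)
      fix \<sigma> \<tau> assume \<sigma>: "\<sigma> \<in> ?L" "\<tau> \<succeq> \<sigma>"
      show "\<bar>coord a \<tau>\<bar> \<le> of_bool (\<sigma> = node (n - 1) s)"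
      proof (cases "\<tau> \<in> range (\<lambda>m. node m s)")
        case True
        with \<sigma> show ?thesis using on by (auto simp: node_extends_iff)
      qed (simp add: off)
    qed
    also have "\<dots> \<le> 1" by (simp add: of_bool_def finite_level)
    finally show "level_norm (coord a) n \<le> 1" .
  qed
  moreover have "(\<Sum>n<M. c n *\<^sub>R completion_embed (basis_vector (node n s))) = completion_embed a"
    by (simp add: a_def linear_sum[OF linear_completion_embed] completion_embed_scaleR)
  ultimately show ?thesis by (simp add: norm_completion_embed)
qed


section \<open>Dilations modulo one and recurrence\<close>

text \<open>The points of the unit interval that \<open>d\<close> maps to within \<open>\<delta>\<close> of an integer lie in \<open>\<bar>d\<bar> + 1\<close>
  intervals of length \<open>2 * \<delta> / \<bar>d\<bar>\<close>, one around each multiple of \<open>1 / \<bar>d\<bar>\<close>; and \<open>\<bar>d\<bar> + 1\<close> is at most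
  \<open>2 * \<bar>d\<bar>\<close>.\<close>

lemma measure_near_integers_le:
  fixes d :: int
  assumes d: "d \<noteq> 0" and \<delta>: "0 < \<delta>" "\<delta> \<le> 1 / 2" and S: "S \<in> sets lebesgue"
    and near: "\<And>t. t \<in> S \<Longrightarrow> 0 \<le> t \<and> t \<le> 1 \<and> (\<exists>p::int. \<bar>of_int d * t - of_int p\<bar> < \<delta>)"
  shows "measure lebesgue S \<le> 4 * \<delta>"
proof -
  define e where "e = \<bar>d\<bar>"
  have e: "e \<ge> 1" using d by (simp add: e_def)
  define J where "J p = {(of_int p - \<delta>) / of_int e..(of_int p + \<delta>) / of_int e}" for p :: int
  have "S \<subseteq> (\<Union>p\<in>{0..e}. J p)"
  proof
    fix t assume t: "t \<in> S"
    then obtain p :: int where "\<bar>of_int d * t - of_int p\<bar> < \<delta>" using near by blast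
    moreover define q where "q = sgn d * p"
    ultimately have q: "\<bar>of_int e * t - of_int q\<bar> < \<delta>"
      using d by (cases "d > 0") (auto simp: e_def q_def)
    have "0 \<le> of_int e * t" "of_int e * t \<le> of_int e"
      using near[OF t] e by (auto simp: mult_left_le)
    with q \<delta> have "of_int (- 1) < (of_int q :: real)" "of_int q < (of_int (e + 1) :: real)" by auto
    then have "q \<in> {0..e}" unfolding of_int_less_iff by simp
    moreover have "t \<in> J q" using q e by (simp add: J_def field_simps abs_less_iff)
    ultimately show "t \<in> (\<Union>p\<in>{0..e}. J p)" by blast
  qed
  moreover have "(\<Union>p\<in>{0..e}. J p) \<in> lmeasurable"
    by (intro fmeasurable.finite_UN) (auto simp: J_def)
  ultimately have "measure lebesgue S \<le> measure lebesgue (\<Union>p\<in>{0..e}. J p)"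
    using S by (intro measure_mono_fmeasurable)
  also have "\<dots> \<le> (\<Sum>p\<in>{0..e}. measure lebesgue (J p))"
    by (rule measure_UNION_le) (auto simp: J_def)
  also have "\<dots> = (\<Sum>p\<in>{0..e}. 2 * \<delta> / of_int e)"
    using e \<delta> by (intro sum.cong refl) (simp add: J_def divide_right_mono diff_divide_distrib[symmetric])
  also have "\<dots> = (of_int e + 1) * (2 * \<delta> / of_int e)" using e by simp
  also have "\<dots> \<le> (2 * of_int e) * (2 * \<delta> / of_int e)"
    using e \<delta> by (intro mult_right_mono) auto
  also have "\<dots> = 4 * \<delta>" using e by simp
  finally show ?thesis .
qed

text \<open>The dilated set consists of \<open>c\<close> translated copies, scaled by \<open>1 / c\<close>, of one period of \<open>P\<close>.\<close>

lemma measure_periodic_dilation_le: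
  fixes P :: "real set" and c :: nat
  assumes c: "c \<ge> 1" and P [measurable]: "P \<in> sets borel"
    and per: "\<And>s (p::int). s + of_int p \<in> P \<longleftrightarrow> s \<in> P"
  shows "measure lebesgue {t\<in>{0..1}. real c * t \<in> P} \<le> measure lebesgue {s\<in>{0..1}. s \<in> P}"
proof -
  define Q where "Q = {s\<in>{0..1}. s \<in> P}"
  have Q [measurable]: "Q \<in> sets borel" unfolding Q_def by measurable
  define J where "J j = (\<lambda>s. (1 / real c) *\<^sub>R s + real j / real c) ` Q" for j
  have mJ: "measure lebesgue (J j) = measure lebesgue Q / c" for j
    unfolding J_def using measure_lebesgue_affine[of "1 / real c" "real j / real c" Q] c by simp
  have J: "J j \<in> lmeasurable" for j
  proof (rule fmeasurableI2)
    have "J j = {t. real c * t - real j \<in> Q}"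
      unfolding J_def using c by (auto simp: image_iff field_simps intro!: bexI[of _ "real c * _ - real j"])
    also have "\<dots> \<in> sets borel" by measurable
    finally show "J j \<in> sets lebesgue" by simp
    show "J j \<subseteq> {real j / c..(1 + real j) / c}"
      using c by (auto simp: J_def Q_def field_simps)
  qed simp
  have PQ: "{t\<in>{0..1}. real c * t \<in> P} \<in> sets borel" by measurable
  have "{t\<in>{0..1}. real c * t \<in> P} \<subseteq> (\<Union>j<c. J j)"
  proof
    fix t assume t: "t \<in> {t\<in>{0..1}. real c * t \<in> P}"
    \<comment> \<open>The minimum matters only for \<open>t = 1\<close>, which belongs to the last copy.\<close>
    define j where "j = min (nat \<lfloor>real c * t\<rfloor>) (c - 1)"
    have nn: "0 \<le> real c * t" "real c * t \<le> real c" using t by (auto simp: mult_left_le)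
    have j: "j < c" "real j \<le> real c * t" "real c * t \<le> real j + 1"
    proof -
      show "j < c" using c by (simp add: j_def)
      have "real j \<le> real (nat \<lfloor>real c * t\<rfloor>)" by (simp add: j_def)
      also have "\<dots> \<le> real c * t" using nn by simp
      finally show "real j \<le> real c * t" .
      show "real c * t \<le> real j + 1"
      proof (cases "nat \<lfloor>real c * t\<rfloor> \<le> c - 1")
        case True
        then have "real j = of_int \<lfloor>real c * t\<rfloor>" using nn by (simp add: j_def)
        then show ?thesis by linarith
      next
        case False
        then show ?thesis using nn c by (simp add: j_def min_def)
      qed
    qed
    have "real c * t - real j \<in> P" using per[of "real c * t" "- int j"] t by simp
    with j have "real c * t - real j \<in> Q" by (simp add: Q_def)
    moreover have "t = (1 / real c) *\<^sub>R (real c * t - real j) + real j / real c"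
      using c by (simp add: field_simps)
    ultimately have "t \<in> J j" unfolding J_def by (rule rev_image_eqI)
    with j show "t \<in> (\<Union>j<c. J j)" by blast
  qed
  then have "measure lebesgue {t\<in>{0..1}. real c * t \<in> P} \<le> measure lebesgue (\<Union>j<c. J j)"
    using PQ J by (intro measure_mono_fmeasurable fmeasurable.finite_UN) auto
  also have "\<dots> \<le> (\<Sum>j<c. measure lebesgue (J j))"
    using J by (intro measure_UNION_le) (auto simp: fmeasurableD)
  also have "\<dots> = measure lebesgue Q" using c by (simp add: mJ)
  finally show ?thesis by (simp add: Q_def)
qed

text \<open>The tails \<open>\<Union>n\<ge>m. B n\<close> decrease to the set of points that belong to infinitely many \<open>B n\<close>, which
  therefore has measure at least \<open>\<epsilon>\<close>.\<close>

lemma (in finite_measure) exists_in_infinitely_many: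
  fixes B :: "nat \<Rightarrow> 'a set"
  assumes B: "\<And>n. B n \<in> sets M" and \<epsilon>: "\<epsilon> > 0" "\<And>n. \<epsilon> \<le> measure M (B n)"
  shows "\<exists>x. infinite {n. x \<in> B n}"
proof -
  define D where "D m = (\<Union>n\<in>{m..}. B n)" for m
  have D: "range D \<subseteq> sets M" using B by (auto simp: D_def)
  have "decseq D" unfolding D_def by (intro antimonoI UN_mono) auto
  from finite_Lim_measure_decseq[OF D this]
  have "(\<lambda>m. measure M (D m)) \<longlonglongrightarrow> measure M (\<Inter>m. D m)" .
  moreover have "\<epsilon> \<le> measure M (D m)" for m
    by (rule order_trans[OF \<epsilon>(2)[of m] finite_measure_mono]) (use D in \<open>auto simp: D_def\<close>)
  ultimately have "\<epsilon> \<le> measure M (\<Inter>m. D m)" by (intro LIMSEQ_le_const) auto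
  then have "(\<Inter>m. D m) \<noteq> {}" using \<epsilon>(1) by (metis measure_empty not_le)
  then obtain x where "x \<in> (\<Inter>m. D m)" by blast
  then have "\<exists>n\<ge>m. x \<in> B n" for m by (auto simp: D_def)
  then show ?thesis by (force simp: infinite_nat_iff_unbounded_le)
qed


section \<open>The sequence of rotated branches\<close>

text \<open>The functions \<open>f\<^sub>n\<close> of the counterexample. Along \<open>node n t\<close> itself the sequence would not be
  weakly null: adding up the coordinates along the branch of \<open>t\<close>, for each \<open>t\<close>, gives a functional that
  is \<open>1\<close> on every member. The factors \<open>n + 1\<close> make the branches used for different \<open>n\<close> nearly
  independent in pairs.\<close>

definition rotated_branch :: "nat \<Rightarrow> real \<Rightarrow> tree_space \<Rightarrow>\<^sub>L real" where
  "rotated_branch n t = coord_functional (node n (real (Suc n) * t))"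

abbreviation unit_lebesgue :: "real measure" where
  "unit_lebesgue \<equiv> lebesgue_on {0..1}"

lemma finite_measure_unit_lebesgue: "finite_measure unit_lebesgue"
  by (rule finite_measure_lebesgue_on) simp

lemma simple_function_rotated_branch: "simple_function unit_lebesgue (rotated_branch n)"
proof -
  have "simple_function unit_lebesgue (\<lambda>t. node n (real (Suc n) * t))"
    unfolding simple_function_def
  proof (intro conjI ballI)
    show "finite ((\<lambda>t. node n (real (Suc n) * t)) ` space unit_lebesgue)"
      by (rule finite_subset[OF _ finite_level[of "Suc n"]]) auto
    fix \<sigma>
    have "{t. node n (real (Suc n) * t) = \<sigma>} \<inter> {0..1} \<in> sets borel"
      by (intro sets.Int sets_node_eq) simp
    then show "(\<lambda>t. node n (real (Suc n) * t)) -` {\<sigma>} \<inter> space unit_lebesgue \<in> sets unit_lebesgue"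
      by (simp add: vimage_def sets_restrict_space_iff space_restrict_space)
  qed
  then show ?thesis
    unfolding rotated_branch_def by (rule simple_function_compose1)
qed

text \<open>The event that the words used by \<open>f\<^sub>i\<close> and \<open>f\<^sub>j\<close> share their first \<open>k + 1\<close> digits.\<close>

definition collision :: "nat \<Rightarrow> nat \<Rightarrow> nat \<Rightarrow> real set" where
  "collision k i j = {t\<in>{0..1}. node k (real (Suc i) * t) = node k (real (Suc j) * t)}"

lemma sets_collision: "collision k i j \<in> sets borel"
proof -
  have "collision k i j = (\<Union>\<sigma>\<in>{\<sigma>. level \<sigma> = Suc k}.
      {t. node k (real (Suc i) * t) = \<sigma>} \<inter> {t. node k (real (Suc j) * t) = \<sigma>} \<inter> {0..1})"
    by (auto simp: collision_def)
  also have "\<dots> \<in> sets borel"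
    by (intro sets.finite_UN finite_level sets.Int sets_node_eq) simp
  finally show ?thesis .
qed

lemma measure_collision_le:
  assumes "i \<noteq> j"
  shows "measure lebesgue (collision k i j) \<le> 4 / 2 ^ Suc k"
proof -
  have "collision k i j \<in> sets lebesgue" using sets_collision by simp
  moreover have "(1::real) / 2 ^ Suc k \<le> 1 / 2" by (simp add: field_simps)
  moreover have "\<exists>p::int. \<bar>of_int (int i - int j) * t - of_int p\<bar> < 1 / 2 ^ Suc k" if "t \<in> collision k i j" for t
    using node_eq_imp_close_mod_1[of k "real (Suc i) * t" "real (Suc j) * t"] that
    by (simp add: collision_def left_diff_distrib distrib_right)
  ultimately have "measure lebesgue (collision k i j) \<le> 4 * (1 / 2 ^ Suc k)"
    using assms by (intro measure_near_integers_le[of "int i - int j"]) (auto simp: collision_def)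
  then show ?thesis by simp
qed

text \<open>The pointwise bound controls the square of the norm. The inequality
  \<open>x \<le> y / 2 + x\<^sup>2 / (2 * y)\<close> with \<open>y = \<eta> * N\<close> makes it linear in the number of collisions, which can be
  integrated term by term: the \<open>N\<close> diagonal pairs contribute at most \<open>1\<close> each and the
  others at most \<open>4 / 2 ^ Suc k\<close>.\<close>

lemma L1_norm_sum_rotated_branch_le:
  fixes \<eta> :: real
  assumes I: "finite I" "I \<subseteq> {k..}" and \<eta>: "\<eta> > 0"
  shows "L1_norm unit_lebesgue (\<lambda>t. \<Sum>i\<in>I. rotated_branch i t)
      \<le> \<eta> * card I / 2 + (card I + 4 / 2 ^ Suc k * (real (card I))\<^sup>2) / (2 * \<eta> * card I)"
proof (cases "I = {}")
  case True
  then show ?thesis by (simp add: L1_norm_def)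
next
  case False
  define N where "N = real (card I)"
  have N: "N > 0" using I False by (simp add: N_def card_gt_0_iff)
  have S_sets: "collision k i j \<in> sets unit_lebesgue" for i j
    using sets_collision by (auto simp: sets_restrict_space_iff collision_def)
  interpret finite_measure unit_lebesgue by (rule finite_measure_unit_lebesgue)
  have mS: "measure unit_lebesgue (collision k i j) \<le> of_bool (i = j) + 4 / 2 ^ Suc k" for i j
  proof (cases "i = j")
    case True
    have "measure unit_lebesgue (collision k i j) \<le> measure unit_lebesgue (space unit_lebesgue)" by (rule bounded_measure)
    also have "\<dots> = 1" by (simp add: measure_restrict_space)
    finally show ?thesis using True by (simp add: add_increasing2)
  next
    case False
    have "measure unit_lebesgue (collision k i j) = measure lebesgue (collision k i j)"
      by (rule measure_restrict_space) (auto simp: collision_def)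
    with measure_collision_le[OF False] False show ?thesis by (simp add: collision_def)
  qed
  define h where "h t = \<eta> * N / 2 + (\<Sum>i\<in>I. \<Sum>j\<in>I. indicator (collision k i j) t) / (2 * \<eta> * N)" for t
  have int_S: "integrable unit_lebesgue (indicator (collision k i j) :: real \<Rightarrow> real)" for i j
    using S_sets by (simp add: less_top[symmetric])
  then have int_h: "integrable unit_lebesgue h"
    unfolding h_def by (intro Bochner_Integration.integrable_add integrable_divide
        Bochner_Integration.integrable_sum integrable_const)
  have bound: "norm (\<Sum>i\<in>I. rotated_branch i t) \<le> h t" if "t \<in> space unit_lebesgue" for t
  proof -
    define x where "x = norm (\<Sum>i\<in>I. rotated_branch i t)"
    have "x\<^sup>2 \<le> (\<Sum>i\<in>I. \<Sum>j\<in>I. of_bool (node k (real (Suc i) * t) = node k (real (Suc j) * t)))"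
      unfolding x_def rotated_branch_def
      by (rule norm_sum_coord_functional_le[where k = "Suc k"]) (use I in \<open>auto intro!: node_extends_node\<close>)
    also have "\<dots> = (\<Sum>i\<in>I. \<Sum>j\<in>I. indicator (collision k i j) t)"
      using that by (simp add: collision_def indicator_def of_bool_def)
    finally have "x\<^sup>2 / (2 * \<eta> * N) \<le> (\<Sum>i\<in>I. \<Sum>j\<in>I. indicator (collision k i j) t) / (2 * \<eta> * N)"
      using \<eta> N by (intro divide_right_mono) auto
    moreover have "x \<le> y / 2 + x\<^sup>2 / (2 * y)" if "y > 0" for y
    proof -
      have "0 \<le> (x - y)\<^sup>2" by simp
      then have "2 * y * x \<le> y\<^sup>2 + x\<^sup>2" by (simp add: power2_diff algebra_simps)
      then show ?thesis using that by (simp add: field_simps power2_eq_square)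
    qed
    from this[of "\<eta> * N"] have "x \<le> \<eta> * N / 2 + x\<^sup>2 / (2 * \<eta> * N)"
      using \<eta> N by (simp add: mult.assoc)
    ultimately show ?thesis by (simp add: x_def h_def)
  qed
  have h_nonneg: "0 \<le> h t" for t
    using \<eta> N by (auto simp: h_def intro!: add_nonneg_nonneg divide_nonneg_nonneg sum_nonneg)
  have "(\<integral>\<^sup>+t. ennreal (norm (\<Sum>i\<in>I. rotated_branch i t)) \<partial>unit_lebesgue) \<le> (\<integral>\<^sup>+t. ennreal (h t) \<partial>unit_lebesgue)"
    by (intro nn_integral_mono ennreal_leI bound)
  also have "\<dots> = ennreal (\<integral>t. h t \<partial>unit_lebesgue)"
    by (rule nn_integral_eq_integral[OF int_h]) (simp add: h_nonneg)
  finally have "L1_norm unit_lebesgue (\<lambda>t. \<Sum>i\<in>I. rotated_branch i t) \<le> (\<integral>t. h t \<partial>unit_lebesgue)"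
    unfolding L1_norm_def by (intro enn2real_leI integral_nonneg_AE) (simp_all add: h_nonneg)
  also have "(\<integral>t. h t \<partial>unit_lebesgue) = \<eta> * N / 2 + (\<Sum>i\<in>I. \<Sum>j\<in>I. measure unit_lebesgue (collision k i j)) / (2 * \<eta> * N)"
  proof -
    have "(\<integral>t. \<eta> * N / 2 \<partial>unit_lebesgue) = \<eta> * N / 2"
      by (simp add: measure_restrict_space)
    moreover have "(\<integral>t. indicator (collision k i j) t \<partial>unit_lebesgue) = measure unit_lebesgue (collision k i j)" for i j
    proof -
      have "collision k i j \<inter> space unit_lebesgue = collision k i j" by (auto simp: collision_def)
      then show ?thesis by (simp only: Bochner_Integration.integral_indicator)
    qed
    moreover have "(\<integral>t. (\<Sum>i\<in>I. \<Sum>j\<in>I. indicator (collision k i j) t :: real) \<partial>unit_lebesgue) = (\<Sum>i\<in>I. \<Sum>j\<in>I. \<integral>t. indicator (collision k i j) t \<partial>unit_lebesgue)"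
      by (subst Bochner_Integration.integral_sum | intro Bochner_Integration.integrable_sum int_S sum.cong refl)+
    ultimately show ?thesis
      unfolding h_def
      by (subst Bochner_Integration.integral_add)
         (auto intro!: integrable_divide Bochner_Integration.integrable_sum int_S)
  qed
  also have "\<dots> \<le> \<eta> * N / 2 + (\<Sum>i\<in>I. \<Sum>j\<in>I. of_bool (i = j) + 4 / 2 ^ Suc k) / (2 * \<eta> * N)"
    using \<eta> N by (intro add_left_mono divide_right_mono sum_mono mS) auto
  also have "(\<Sum>i\<in>I. \<Sum>j\<in>I. of_bool (i = j) + 4 / 2 ^ Suc k) = N + 4 / 2 ^ Suc k * N\<^sup>2"
    using I by (simp add: sum.distrib N_def of_bool_def power2_eq_square distrib_left)
  finally show ?thesis by (simp add: N_def)
qed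

text \<open>After division by \<open>N\<close>, the second term of the previous bound is \<open>1 / N + 2 / 2 ^ k\<close>
  over \<open>2 * \<eta>\<close>; so it suffices that \<open>1 / N\<close> and \<open>2 / 2 ^ k\<close> are both below \<open>\<eta>\<^sup>2 / 2\<close>.\<close>

lemma small_averages_rotated_branch:
  fixes \<eta> :: real
  assumes \<eta>: "\<eta> > 0"
  shows "\<exists>k N. N > 0 \<and> (\<forall>I\<subseteq>{k..}. card I = N \<longrightarrow>
           L1_norm unit_lebesgue (\<lambda>t. \<Sum>i\<in>I. rotated_branch i t) \<le> \<eta> * real N)"
proof -
  obtain k where k: "(1 / 2) ^ k < \<eta>\<^sup>2 / 4"
    using real_arch_pow_inv[of "\<eta>\<^sup>2 / 4" "1 / 2"] \<eta> by auto
  obtain n where "inverse (real (Suc n)) < \<eta>\<^sup>2 / 2"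
    using reals_Archimedean[of "\<eta>\<^sup>2 / 2"] \<eta> by auto
  moreover define N where "N = Suc n"
  ultimately have N: "N > 0" "1 / real N < \<eta>\<^sup>2 / 2"
    by (simp_all add: inverse_eq_divide)
  have "L1_norm unit_lebesgue (\<lambda>t. \<Sum>i\<in>I. rotated_branch i t) \<le> \<eta> * real N"
    if I: "I \<subseteq> {k..}" "card I = N" for I
  proof -
    have "finite I" using I N card_ge_0_finite by blast
    from L1_norm_sum_rotated_branch_le[OF this I(1) \<eta>]
    have "L1_norm unit_lebesgue (\<lambda>t. \<Sum>i\<in>I. rotated_branch i t)
        \<le> \<eta> * N / 2 + (N + 4 / 2 ^ Suc k * (real N)\<^sup>2) / (2 * \<eta> * N)" by (simp add: I)
    also have "(N + 4 / 2 ^ Suc k * (real N)\<^sup>2) / (2 * \<eta> * N) = (1 / N + 2 * (1 / 2) ^ k) * (N / (2 * \<eta>))"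
      using N \<eta> by (simp add: field_simps power2_eq_square)
    also have "\<dots> \<le> \<eta>\<^sup>2 * (N / (2 * \<eta>))"
      using k N \<eta> by (intro mult_right_mono) auto
    also have "\<dots> = \<eta> * N / 2" using \<eta> by (simp add: field_simps power2_eq_square)
    finally show ?thesis by simp
  qed
  with N show ?thesis by blast
qed

lemma finite_branch_in_weakly_compact:
  assumes "weakly_compact W"
  shows "finite {n. coord_functional (node n s) \<in> W}"
  by (rule finite_biorthogonal_in_weakly_compact[OF norm_branch_sum_le _ assms])
     (auto simp: basis_vector.rep_eq)

text \<open>Whether \<open>f\<^sub>n(t)\<close> belongs to \<open>W\<close> depends only on \<open>(n + 1) t\<close> modulo one, so undoing the dilation
  replaces \<open>f\<^sub>n(t)\<close> by the coordinate functional at \<open>node n s\<close>, and these nodes form one branch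
  for each \<open>s\<close>.\<close>

lemma exists_branch_infinitely_often:
  assumes "\<epsilon> > 0"
    and large: "\<And>n. \<epsilon> \<le> measure unit_lebesgue (rotated_branch n -` W \<inter> space unit_lebesgue)"
  shows "\<exists>s. infinite {n. coord_functional (node n s) \<in> W}"
proof -
  interpret finite_measure unit_lebesgue by (rule finite_measure_unit_lebesgue)
  define P where "P n = {s. coord_functional (node n s) \<in> W}" for n
  define B where "B n = {s\<in>{0..1}. s \<in> P n}" for n
  have P: "P n \<in> sets borel" for n
  proof -
    have "P n = (\<Union>\<sigma>\<in>{\<sigma>. level \<sigma> = Suc n \<and> coord_functional \<sigma> \<in> W}. {s. node n (1 * s) = \<sigma>})"
      by (auto simp: P_def)
    also have "\<dots> \<in> sets borel"
      by (intro sets.finite_UN sets_node_eq finite_subset[OF _ finite_level[of "Suc n"]]) auto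
    finally show ?thesis .
  qed
  have measure_B: "measure unit_lebesgue (B n) = measure lebesgue (B n)" for n
    by (rule measure_restrict_space) (auto simp: B_def)
  have "\<exists>s. infinite {n. s \<in> B n}"
  proof (rule exists_in_infinitely_many[OF _ assms(1)])
    fix n
    have [measurable]: "P n \<in> sets borel" by (rule P)
    have "B n \<in> sets borel" unfolding B_def by measurable
    then show "B n \<in> sets unit_lebesgue" by (auto simp: sets_restrict_space_iff B_def)
    have "rotated_branch n -` W \<inter> space unit_lebesgue = {t\<in>{0..1}. real (Suc n) * t \<in> P n}"
      by (auto simp: rotated_branch_def P_def)
    then have "\<epsilon> \<le> measure lebesgue {t\<in>{0..1}. real (Suc n) * t \<in> P n}"
      using large[of n] by (subst (asm) measure_restrict_space) auto
    also have "\<dots> \<le> measure lebesgue (B n)"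
      unfolding B_def by (rule measure_periodic_dilation_le[OF _ P]) (simp_all add: P_def)
    finally show "\<epsilon> \<le> measure unit_lebesgue (B n)" by (simp add: measure_B)
  qed
  then obtain s where "infinite {n. s \<in> B n}" ..
  then have "infinite {n. coord_functional (node n s) \<in> W}"
    by (rule contrapos_nn) (auto simp: B_def P_def elim: rev_finite_subset)
  then show ?thesis ..
qed

theorem theorem2p9:
  shows "\<not> property_deltaS (lebesgue_on {0..1::real}) TYPE(tree_space \<Rightarrow>\<^sub>L real)"
proof
  assume "property_deltaS unit_lebesgue TYPE(tree_space \<Rightarrow>\<^sub>L real)"
  moreover have "L1_relatively_weakly_compact unit_lebesgue (range (\<lambda>n. L1_class unit_lebesgue (rotated_branch n)))"
    by (rule L1_relatively_weakly_compact_if_small_averages[OF finite_measure_unit_lebesgue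
          simple_function_rotated_branch small_averages_rotated_branch])
  ultimately have "deltaS_set unit_lebesgue (range (\<lambda>n. L1_class unit_lebesgue (rotated_branch n)))"
    unfolding property_deltaS_def by blast
  then have "\<exists>W :: (tree_space \<Rightarrow>\<^sub>L real) set. weakly_compact W \<and>
      (\<forall>F\<in>range (\<lambda>n. L1_class unit_lebesgue (rotated_branch n)). \<forall>f\<in>F.
        f \<in> borel_measurable unit_lebesgue \<longrightarrow> 1 - 1 / 2 \<le> measure unit_lebesgue (f -` W \<inter> space unit_lebesgue))"
    unfolding deltaS_set_def by (elim conjE allE[of _ "1 / 2"]) simp
  then obtain W :: "(tree_space \<Rightarrow>\<^sub>L real) set" where W: "weakly_compact W"
    and large: "\<And>n f. f \<in> L1_class unit_lebesgue (rotated_branch n) \<Longrightarrow> f \<in> borel_measurable unit_lebesgue \<Longrightarrow>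
        1 - 1 / 2 \<le> measure unit_lebesgue (f -` W \<inter> space unit_lebesgue)"
    by blast
  have "1 / 2 \<le> measure unit_lebesgue (rotated_branch n -` W \<inter> space unit_lebesgue)" for n
    using large[of "rotated_branch n" n] simple_function_rotated_branch[of n]
      simple_function_imp_bochner_integrable[OF finite_measure_unit_lebesgue simple_function_rotated_branch]
    by (simp add: L1_class_def borel_measurable_simple_function)
  then obtain s where "infinite {n. coord_functional (node n s) \<in> W}"
    using exists_branch_infinitely_often[of "1 / 2" W] by auto
  with finite_branch_in_weakly_compact[OF W] show False by blast
qed

end
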